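(* Let $k\ge 1$ be an odd square-free integer with $\gcd(k,5)=1$, and let $K_k=\mathbb{Q}\big(\sqrt{k(5+\sqrt5)}\big)$. Then \[ \tfrac{1}{1920}\, D_{K_k}^{1/2} \le M(\mathcal{O}_{K_k}) \le D_{K_k}^{1/2}. \]
   Context: For a nonconstant polynomial $f(x)=c\prod_{i=1}^d (x-\alpha_i)\in\mathbb{C}[x]$, the Mahler measure is $M(f)=|c|\prod_{|\alpha_i|\ge 1}|\alpha_i|$. For an algebraic number $\alpha$, $M(\alpha)$ is the Mahler measure of its minimal polynomial over $\mathbb{Z}$ (with content $1$). For a number field $K$ with ring of integers $\mathcal{O}_K$ and absolute discriminant $D_K$, $M(\mathcal{O}_K)=\min\{M(\alpha):\alpha\in\mathcal{O}_K,\ \mathbb{Q}(\alpha)=K\}$. *)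

theory Defs
  imports Complex_Main "HOL-Library.FuncSet" "HOL-Computational_Algebra.Polynomial"
    "HOL-Computational_Algebra.Polynomial_Factorial"
    "HOL-Computational_Algebra.Squarefree" "Jordan_Normal_Form.Determinant"
begin

definition is_subfield :: "complex set \<Rightarrow> bool" where
  "is_subfield F \<longleftrightarrow> 0 \<in> F \<and> 1 \<in> F \<and>
     (\<forall>x\<in>F. \<forall>y\<in>F. x + y \<in> F \<and> x - y \<in> F \<and> x * y \<in> F) \<and>
     (\<forall>x\<in>F. x \<noteq> 0 \<longrightarrow> inverse x \<in> F)"

definition gen_field :: "complex \<Rightarrow> complex set" where
  "gen_field a = \<Inter>{F. is_subfield F \<and> a \<in> F}"

definition alg_int :: "complex \<Rightarrow> bool" where
  "alg_int x \<longleftrightarrow> (\<exists>p :: int poly. lead_coeff p = 1 \<and> poly (map_poly of_int p) x = 0)"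

definition ring_of_integers :: "complex set \<Rightarrow> complex set" where
  "ring_of_integers K = {x \<in> K. alg_int x}"

definition mahler_measure :: "complex poly \<Rightarrow> real" where
  "mahler_measure p = cmod (lead_coeff p) *
     (\<Prod>z\<in>{z. poly p z = 0}. max 1 (cmod z) ^ order z p)"

definition min_poly_int :: "complex \<Rightarrow> int poly" where
  "min_poly_int a = (THE p. irreducible p \<and> lead_coeff p > 0 \<and> poly (map_poly of_int p) a = 0)"

definition mahler_alg :: "complex \<Rightarrow> real" where
  "mahler_alg a = mahler_measure (map_poly of_int (min_poly_int a))"

text \<open>M(O_K) = min of M(a) over a in O_K with Q(a) = K (written as Inf; the minimum exists).\<close>
definition mahler_OK :: "complex set \<Rightarrow> real" where
  "mahler_OK K = Inf {mahler_alg a | a. a \<in> ring_of_integers K \<and> gen_field a = K}"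

definition embeddings :: "complex set \<Rightarrow> (complex \<Rightarrow> complex) set" where
  "embeddings K = {\<sigma> \<in> K \<rightarrow>\<^sub>E (UNIV :: complex set). \<sigma> 1 = 1 \<and>
      (\<forall>x\<in>K. \<forall>y\<in>K. \<sigma> (x + y) = \<sigma> x + \<sigma> y \<and> \<sigma> (x * y) = \<sigma> x * \<sigma> y)}"

definition trace_K :: "complex set \<Rightarrow> complex \<Rightarrow> complex" where
  "trace_K K x = (\<Sum>\<sigma>\<in>embeddings K. \<sigma> x)"

definition integral_basis :: "complex set \<Rightarrow> nat \<Rightarrow> (nat \<Rightarrow> complex) \<Rightarrow> bool" where
  "integral_basis K n w \<longleftrightarrow> (\<forall>i<n. w i \<in> ring_of_integers K) \<and>
     (\<forall>x\<in>ring_of_integers K. \<exists>!c \<in> {..<n} \<rightarrow>\<^sub>E (UNIV :: int set).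
         x = (\<Sum>i<n. of_int (c i) * w i))"

definition abs_disc :: "complex set \<Rightarrow> real" where
  "abs_disc K = (SOME D. \<exists>n w. integral_basis K n w \<and>
      D = cmod (det (mat n n (\<lambda>(i, j). trace_K K (w i * w j)))))"

end

theory Submission
  imports Defs "Jordan_Normal_Form.Char_Poly" "HOL-Computational_Algebra.Fundamental_Theorem_Algebra"
begin

text \<open>
  Write \<open>\<phi> = (1 + \<surd>5) / 2\<close> and \<open>\<theta> = \<surd>(k (5 + \<surd>5))\<close>, so that \<open>\<theta>\<^sup>2 = 2 k \<surd>5 \<phi>\<close>, where \<open>2 k \<surd>5\<close> is
  square-free in \<open>\<int>[\<phi>]\<close> and \<open>2\<close> is inert. Hence the ring of integers is \<open>\<int>[\<phi>] + \<int>[\<phi>] \<theta>\<close>, the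
  discriminant is \<open>8000 k\<^sup>2\<close> and its square root is \<open>40 \<surd>5 k\<close>.

  The conjugates of \<open>u + v \<theta>\<close> are \<open>u \<plusminus> v \<theta>\<close> and \<open>u' \<plusminus> v' \<theta>'\<close> with \<open>\<theta> \<theta>' = 2 \<surd>5 k\<close>. One of
  \<open>\<bar>u \<plusminus> v \<theta>\<bar>\<close> is at least \<open>\<bar>v\<bar> \<theta>\<close>, and likewise for the other pair, so a generator has Mahler
  measure at least \<open>\<bar>v v'\<bar> \<theta> \<theta>' \<ge> 2 \<surd>5 k\<close>, as \<open>v v'\<close> is a nonzero integer. Conversely,
  choosing \<open>u \<in> \<int>[\<phi>]\<close> with \<open>u\<close> near \<open>\<theta>\<close> and \<open>u'\<close> near \<open>\<theta>'\<close>, two conjugates of \<open>u + \<theta>\<close> are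
  bounded and the other two are about \<open>2 \<theta>\<close> and \<open>2 \<theta>'\<close>; this gives at most \<open>32 \<surd>5 k\<close>.
\<close>

section \<open>Algebraic integers\<close>

lemma alg_int_iff_algebraic_int: "alg_int x \<longleftrightarrow> algebraic_int x"
  unfolding alg_int_def algebraic_int_altdef_ipoly by blast

definition int_span :: "complex set \<Rightarrow> complex set" where
  "int_span W = {\<Sum>w\<in>W. of_int (c w) * w | c :: complex \<Rightarrow> int. True}"

lemma int_span_base:
  assumes "finite W" "w \<in> W"
  shows "w \<in> int_span W"
proof -
  have "(\<Sum>v\<in>W. of_int (if v = w then 1 else 0) * v) = (\<Sum>v\<in>W. if v = w then v else 0)"
    by (intro sum.cong) auto
  also have "\<dots> = w" using assms by simp
  finally show ?thesis unfolding int_span_def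
    by (intro CollectI exI[of _ "\<lambda>v. if v = w then 1 else 0"]) simp
qed

lemma int_span_add:
  assumes "x \<in> int_span W" "y \<in> int_span W"
  shows "x + y \<in> int_span W"
proof -
  from assms obtain c d :: "complex \<Rightarrow> int" where
    "x = (\<Sum>w\<in>W. of_int (c w) * w)" "y = (\<Sum>w\<in>W. of_int (d w) * w)"
    unfolding int_span_def by blast
  then have "x + y = (\<Sum>w\<in>W. of_int (c w + d w) * w)"
    by (simp add: sum.distrib algebra_simps)
  then show ?thesis unfolding int_span_def
    by (intro CollectI exI[of _ "\<lambda>w. c w + d w"]) simp
qed

lemma int_span_0: "0 \<in> int_span W"
  unfolding int_span_def by (intro CollectI exI[of _ "\<lambda>w. 0"]) simp

lemma int_span_int_mult:
  assumes "x \<in> int_span W"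
  shows "of_int m * x \<in> int_span W"
proof -
  from assms obtain c :: "complex \<Rightarrow> int" where "x = (\<Sum>w\<in>W. of_int (c w) * w)"
    unfolding int_span_def by blast
  then have "of_int m * x = (\<Sum>w\<in>W. of_int (m * c w) * w)"
    by (simp add: sum_distrib_left algebra_simps)
  then show ?thesis unfolding int_span_def
    by (intro CollectI exI[of _ "\<lambda>w. m * c w"]) simp
qed

lemma int_span_sum:
  assumes "\<And>i. i \<in> I \<Longrightarrow> f i \<in> int_span W"
  shows "sum f I \<in> int_span W"
  using assms by (induction I rule: infinite_finite_induct) (auto intro: int_span_0 int_span_add)

lemma int_span_mult:
  assumes "x \<in> int_span V" "y \<in> int_span W" "finite V" "finite W"
  shows "x * y \<in> int_span ((\<lambda>(v, w). v * w) ` (V \<times> W))"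
proof -
  from assms obtain c d :: "complex \<Rightarrow> int" where
    "x = (\<Sum>w\<in>V. of_int (c w) * w)" "y = (\<Sum>w\<in>W. of_int (d w) * w)"
    unfolding int_span_def by blast
  then have "x * y = (\<Sum>v\<in>V. \<Sum>w\<in>W. of_int (c v * d w) * (v * w))"
    by (simp add: sum_product algebra_simps)
  \<comment> \<open>Equal products of different pairs collapse in the image set, so membership is
    checked term by term instead of by exhibiting coefficients.\<close>
  also have "\<dots> \<in> int_span ((\<lambda>(v, w). v * w) ` (V \<times> W))"
    using assms by (intro int_span_sum int_span_int_mult int_span_base) auto
  finally show ?thesis .
qed

text \<open>Multiplication by \<open>x\<close> acts on \<open>W\<close> through an integer matrix, whose characteristic
  polynomial is monic, has integer coefficients, and vanishes at \<open>x\<close>.\<close>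

lemma alg_intI_stable_span:
  assumes "finite W" "w0 \<in> W" "w0 \<noteq> 0" and st: "\<And>w. w \<in> W \<Longrightarrow> x * w \<in> int_span W"
  shows "alg_int x"
proof -
  define n where "n = card W"
  obtain f where f: "bij_betw f {..<n} W"
    using ex_bij_betw_nat_finite[OF assms(1)] by (auto simp: n_def atLeast0LessThan)
  have "\<exists>c :: complex \<Rightarrow> int. x * w = (\<Sum>v\<in>W. of_int (c v) * v)" if "w \<in> W" for w
    using st[OF that] unfolding int_span_def by blast
  then obtain c :: "complex \<Rightarrow> complex \<Rightarrow> int"
    where c: "\<And>w. w \<in> W \<Longrightarrow> x * w = (\<Sum>v\<in>W. of_int (c w v) * v)" by metis
  define A :: "int mat" where "A = mat n n (\<lambda>(i, j). c (f i) (f j))"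
  define v where "v = vec n f"
  have A: "A \<in> carrier_mat n n" and v: "v \<in> carrier_vec n" by (auto simp: A_def v_def)
  let ?A = "map_mat complex_of_int A"
  have A': "?A \<in> carrier_mat n n" using A by simp
  have "?A *\<^sub>v v = x \<cdot>\<^sub>v v"
  proof (rule eq_vecI)
    fix i assume "i < dim_vec (x \<cdot>\<^sub>v v)"
    then have i: "i < n" by (simp add: v_def)
    then have fi: "f i \<in> W" using f by (auto simp: bij_betw_def)
    have "(?A *\<^sub>v v) $ i = (\<Sum>j\<in>{0..<n}. of_int (c (f i) (f j)) * f j)"
      using i by (simp add: A_def v_def scalar_prod_def)
    also have "\<dots> = (\<Sum>u\<in>W. of_int (c (f i) u) * u)"
      by (intro sum.reindex_bij_betw[of f "{0..<n}" W "\<lambda>u. of_int (c (f i) u) * u"])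
         (use f in \<open>simp add: atLeast0LessThan\<close>)
    also have "\<dots> = x * f i" using c[OF fi] by simp
    finally show "(?A *\<^sub>v v) $ i = (x \<cdot>\<^sub>v v) $ i" using i by (simp add: v_def)
  qed (simp add: v_def A_def)
  moreover have "v \<noteq> 0\<^sub>v n"
  proof
    assume v0: "v = 0\<^sub>v n"
    obtain i where "i < n" "f i = w0" using f assms(2) by (auto simp: bij_betw_def)
    then have "v $ i = w0" by (simp add: v_def)
    then show False using v0 \<open>i < n\<close> assms(3) by simp
  qed
  ultimately have "eigenvalue ?A x"
    using v A' unfolding eigenvalue_def eigenvector_def by auto
  then have "poly (char_poly ?A) x = 0"
    using eigenvalue_root_char_poly[OF A'] by simp
  moreover have "char_poly ?A = map_poly of_int (char_poly A)"
    by (rule of_int_hom.char_poly_hom[OF A])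
  moreover have "lead_coeff (char_poly A) = 1"
    using degree_monic_char_poly[OF A] by simp
  ultimately show ?thesis unfolding alg_int_def by (intro exI[of _ "char_poly A"]) simp
qed

text \<open>Take the powers of \<open>x\<close> below the degree of a monic equation; the equation
  rewrites the next power. The element \<open>1\<close> supplies the nonzero vector for the converse
  criterion, also after multiplying two such sets.\<close>

lemma alg_int_stable_span:
  assumes "alg_int x"
  obtains W where "finite W" "1 \<in> W" "\<And>w. w \<in> W \<Longrightarrow> x * w \<in> int_span W"
proof -
  from assms obtain p :: "int poly" where p: "lead_coeff p = 1" "poly (map_poly of_int p) x = 0"
    unfolding alg_int_def by blast
  define n where "n = degree p"
  have n: "n > 0"
  proof (rule ccontr)
    assume "\<not> n > 0"
    then obtain c where "p = [:c:]" unfolding n_def by (metis degree_eq_zeroE gr0I)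
    then show False using p by simp
  qed
  define W where "W = (\<lambda>i. x ^ i) ` {..<n}"
  have W: "finite W" by (simp add: W_def)
  have mem: "x ^ i \<in> int_span W" if "i < n" for i
    using that by (intro int_span_base[OF W]) (auto simp: W_def)
  have "0 = (\<Sum>i\<le>n. of_int (coeff p i) * x ^ i)"
    using p(2) by (simp add: poly_altdef n_def)
  also have "\<dots> = x ^ n + (\<Sum>i<n. of_int (coeff p i) * x ^ i)"
    using p(1) by (simp add: n_def flip: lessThan_Suc_atMost)
  finally have "x ^ n = of_int (-1) * (\<Sum>i<n. of_int (coeff p i) * x ^ i)"
    by (simp add: eq_neg_iff_add_eq_0)
  also have "\<dots> \<in> int_span W"
    by (intro int_span_int_mult int_span_sum mem) auto
  finally have top: "x ^ n \<in> int_span W" .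
  show ?thesis
  proof
    show "finite W" by fact
    show "1 \<in> W" using n by (auto simp: W_def intro!: image_eqI[of _ _ 0])
    fix w assume "w \<in> W"
    then obtain i where i: "i < n" "w = x ^ i" by (auto simp: W_def)
    then have "x * w = x ^ Suc i" by simp
    then show "x * w \<in> int_span W"
      using mem[of "Suc i"] top i by (cases "Suc i = n") auto
  qed
qed

text \<open>If one module is stable under \<open>x\<close> and another under \<open>y\<close>, the
  products of their generators span a module stable under both \<open>x + y\<close> and
  \<open>x * y\<close>.\<close>

lemma
  assumes "alg_int x" "alg_int y"
  shows alg_int_add: "alg_int (x + y)" and alg_int_mult: "alg_int (x * y)"
proof -
  obtain V where V: "finite V" "1 \<in> V" "\<And>w. w \<in> V \<Longrightarrow> x * w \<in> int_span V"
    using alg_int_stable_span[OF assms(1)] by blast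
  obtain W where W: "finite W" "1 \<in> W" "\<And>w. w \<in> W \<Longrightarrow> y * w \<in> int_span W"
    using alg_int_stable_span[OF assms(2)] by blast
  let ?U = "(\<lambda>(v, w). v * w) ` (V \<times> W)"
  have U: "finite ?U" "1 \<in> ?U" using V W by (auto intro!: image_eqI[of _ _ "(1, 1)"])
  have "(x + y) * u \<in> int_span ?U \<and> (x * y) * u \<in> int_span ?U" if "u \<in> ?U" for u
  proof -
    from that obtain v w where vw: "v \<in> V" "w \<in> W" "u = v * w" by auto
    have "(x * v) * w \<in> int_span ?U" "v * (y * w) \<in> int_span ?U" "(x * v) * (y * w) \<in> int_span ?U"
      using vw V W by (auto intro!: int_span_mult intro: int_span_base)
    moreover have "(x + y) * u = (x * v) * w + v * (y * w)" "(x * y) * u = (x * v) * (y * w)"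
      by (auto simp: vw algebra_simps)
    ultimately show ?thesis using int_span_add by presburger
  qed
  then show "alg_int (x + y)" "alg_int (x * y)"
    using alg_intI_stable_span[OF U, of "x + y"] alg_intI_stable_span[OF U, of "x * y"] by auto
qed

lemma alg_int_of_int: "alg_int (of_int m)"
  unfolding alg_int_iff_algebraic_int by (rule int_imp_algebraic_int) auto

lemma alg_int_of_ratD:
  assumes "alg_int (of_rat q)"
  obtains m :: int where "q = of_int m"
proof -
  have "(of_rat q :: complex) \<in> \<int>"
    using assms unfolding alg_int_iff_algebraic_int
    by (intro rational_algebraic_int_is_int) auto
  then obtain m :: int where "(of_rat q :: complex) = of_rat (of_int m)"
    by (auto elim!: Ints_cases)
  then show ?thesis using that by (simp only: of_rat_eq_iff)
qed

section \<open>Minimal polynomials over the integers\<close>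

lemma poly_of_int_mult:
  "poly (map_poly of_int (p * q)) (x :: complex) = poly (map_poly of_int p) x * poly (map_poly of_int q) x"
  by (simp add: of_int_poly_hom.hom_mult)

lemma irreducible_root_degree_pos:
  fixes p :: "int poly" and x :: complex
  assumes "irreducible p" "poly (map_poly of_int p) x = 0"
  shows "degree p > 0"
proof (rule ccontr)
  assume "\<not> degree p > 0"
  then obtain c where "p = [:c:]" by (metis degree_eq_zeroE gr0I)
  then show False using assms by auto
qed

text \<open>Works over the integers throughout: a nonzero \<open>m\<close> of least degree vanishing
  at \<open>x\<close> divides, up to a nonzero integer factor, every polynomial vanishing there.
  Primality of \<open>p\<close> then replaces Gauss's lemma.\<close>

lemma irreducible_dvd_of_root:
  fixes p q :: "int poly" and x :: complex
  assumes irr: "irreducible p" and px: "poly (map_poly of_int p) x = 0"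
    and qx: "poly (map_poly of_int q) x = 0"
  shows "p dvd q"
proof -
  have prm: "prime_elem p" using irr by (rule irreducible_imp_prime_poly)
  have dp: "degree p > 0" using irreducible_root_degree_pos[OF irr px] .
  define P where "P = (\<lambda>m :: int poly. m \<noteq> 0 \<and> poly (map_poly of_int m) x = 0)"
  have "P p" using irr px by (auto simp: P_def)
  then obtain m where m: "P m" "\<And>r. P r \<Longrightarrow> degree m \<le> degree r"
    using ex_has_least_nat[of P p degree] by blast
  have m0: "m \<noteq> 0" and mx: "poly (map_poly of_int m) x = 0" using m(1) by (auto simp: P_def)
  have dm: "degree m > 0"
  proof (rule ccontr)
    assume "\<not> degree m > 0"
    then obtain c where "m = [:c:]" by (metis degree_eq_zeroE gr0I)
    then show False using m0 mx by auto
  qed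
  \<comment> \<open>The pseudo-remainder vanishes at \<open>x\<close> and is either zero or of
    smaller degree than \<open>m\<close>, so it is zero.\<close>
  have div: "\<exists>a s. a \<noteq> 0 \<and> smult a f = m * s" if fx: "poly (map_poly of_int f) x = 0" for f
  proof -
    obtain a s where as: "a \<noteq> 0" "smult a f = m * s + pseudo_mod f m"
      using pseudo_mod(1)[OF m0] by blast
    have "poly (map_poly of_int (pseudo_mod f m)) x = poly (map_poly of_int (smult a f - m * s)) x"
      using as by simp
    also have "\<dots> = 0" using fx mx by (simp add: of_int_poly_hom.hom_minus of_int_hom.map_poly_hom_smult poly_of_int_mult)
    finally have "pseudo_mod f m = 0"
      using pseudo_mod(2)[OF m0, of f] m(2)[of "pseudo_mod f m"] unfolding P_def by (meson leD)
    then show ?thesis using as by auto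
  qed
  have "p dvd m"
  proof -
    obtain a s where as: "a \<noteq> 0" "smult a p = m * s" using div[OF px] by blast
    then have "p dvd m * s" by (metis dvd_refl dvd_smult)
    then consider "p dvd m" | "p dvd s" using prm prime_elem_dvd_multD by blast
    then show ?thesis
    proof cases
      \<comment> \<open>Cancelling \<open>p\<close> would make the nonconstant \<open>m\<close>
        divide a nonzero constant.\<close>
      case 2
      then obtain u where "s = p * u" by (auto elim: dvdE)
      then have "p * [:a:] = p * (m * u)" using as by (simp add: algebra_simps)
      moreover have "p \<noteq> 0" using irr by auto
      ultimately have "[:a:] = m * u" using mult_left_cancel by blast
      then have "m dvd [:a:]" by simp
      then have "degree m \<le> 0" using as(1) by (metis degree_pCons_0 dvd_imp_degree_le pCons_eq_0_iff)
      then show ?thesis using dm by simp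
    qed
  qed
  moreover obtain a s where as: "a \<noteq> 0" "smult a q = m * s" using div[OF qx] by blast
  ultimately have "p dvd m * s" by simp
  then have "p dvd [:a:] * q" using as(2) by simp
  moreover have "\<not> p dvd [:a:]" using as(1) dp by (metis degree_pCons_0 dvd_imp_degree_le leD pCons_eq_0_iff)
  ultimately show ?thesis using prm prime_elem_dvd_multD by blast
qed

text \<open>Makes the \<open>THE\<close> well defined. Existence: some prime factor of a monic
  equation vanishes at \<open>x\<close>. Uniqueness: two candidates divide each other and both have
  positive leading coefficient. Dividing a monic polynomial forces leading coefficient 1.\<close>

lemma min_poly_int:
  assumes "alg_int x"
  shows "irreducible (min_poly_int x)" "lead_coeff (min_poly_int x) = 1"
    "poly (map_poly of_int (min_poly_int x)) x = 0"
proof -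
  from assms obtain f :: "int poly" where f: "lead_coeff f = 1" "poly (map_poly of_int f) x = 0"
    unfolding alg_int_def by blast
  have f0: "f \<noteq> 0" using f by auto
  have factor: "\<exists>q\<in>#A. poly (map_poly of_int q) x = 0"
    if "poly (map_poly of_int (prod_mset A)) x = 0" for A :: "int poly multiset"
    using that by (induction A) (auto simp: poly_of_int_mult)
  have "f dvd prod_mset (prime_factorization f)"
    using associatedD2[OF prod_mset_prime_factorization_weak[OF f0]] .
  then have "poly (map_poly of_int (prod_mset (prime_factorization f))) x = 0"
    using f(2) by (auto elim!: dvdE simp: poly_of_int_mult)
  then obtain q where q: "q \<in># prime_factorization f" "poly (map_poly of_int q) x = 0"
    using factor by blast
  then have qi: "irreducible q"
    by (meson in_prime_factors_imp_prime prime_elem_imp_irreducible prime_imp_prime_elem)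
  define p where "p = (if lead_coeff q > 0 then q else - q)"
  have pq: "p dvd q" "q dvd p" by (auto simp: p_def)
  have p: "irreducible p" "lead_coeff p > 0" "poly (map_poly of_int p) x = 0"
  proof -
    show "irreducible p" using qi irreducible_mult_unit_left[of "-1" q] by (auto simp: p_def)
    have "lead_coeff q \<noteq> 0" using qi by auto
    then show "lead_coeff p > 0" by (auto simp: p_def)
    show "poly (map_poly of_int p) x = 0" using q(2) by (auto simp: p_def of_int_poly_hom.hom_uminus)
  qed
  have "min_poly_int x = p" unfolding min_poly_int_def
  proof (rule the_equality)
    fix r :: "int poly"
    assume r: "irreducible r \<and> lead_coeff r > 0 \<and> poly (map_poly of_int r) x = 0"
    have "r dvd p" "p dvd r" using r p irreducible_dvd_of_root by blast+
    then obtain u v where uv: "p = r * u" "r = p * v" unfolding dvd_def by blast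
    then have "p * 1 = p * (v * u)" by (simp add: algebra_simps)
    moreover have "p \<noteq> 0" using p(1) by auto
    ultimately have "1 = v * u" using mult_left_cancel by blast
    then have "v dvd 1" by (rule dvdI)
    then obtain c where c: "v = [:c:]" "c dvd 1" by (auto simp: is_unit_poly_iff)
    then have "c = 1 \<or> c = -1" by auto
    moreover have "lead_coeff r = lead_coeff p * c" using uv(2) c(1) by (simp add: lead_coeff_mult)
    ultimately have "c = 1" using r p(2) by auto
    then show "r = p" using uv(2) c(1) by simp
  qed (use p in auto)
  moreover have "p dvd f" using irreducible_dvd_of_root[OF p(1) p(3) f(2)] .
  then have "lead_coeff p dvd lead_coeff f" by (auto elim!: dvdE simp: lead_coeff_mult)
  then have "lead_coeff p dvd 1" using f(1) by simp
  then have "lead_coeff p = 1" using p(2) by simp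
  ultimately show "irreducible (min_poly_int x)" "lead_coeff (min_poly_int x) = 1"
    "poly (map_poly of_int (min_poly_int x)) x = 0" using p by auto
qed

section \<open>Mahler measure and distinct roots\<close>

text \<open>Discarding roots outside \<open>S\<close>, multiplicities and the leading coefficient
  only removes factors that are at least 1.\<close>

lemma mahler_measure_ge_prod:
  assumes "cmod (lead_coeff p) \<ge> 1" "\<And>z. z \<in> S \<Longrightarrow> poly p z = 0"
  shows "(\<Prod>z\<in>S. max 1 (cmod z)) \<le> mahler_measure p"
proof -
  let ?R = "{z. poly p z = 0}"
  have p0: "p \<noteq> 0" using assms(1) by auto
  have fin: "finite ?R" using p0 by (rule poly_roots_finite)
  have "(\<Prod>z\<in>S. max 1 (cmod z)) \<le> (\<Prod>z\<in>?R. max 1 (cmod z))"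
    using assms fin by (intro prod_mono2) auto
  also have "\<dots> \<le> (\<Prod>z\<in>?R. max 1 (cmod z) ^ order z p)"
  proof (intro prod_mono conjI)
    fix z assume z: "z \<in> ?R"
    then have "order z p \<ge> 1" using p0 by (simp add: order_root Suc_leI)
    then have "max 1 (cmod z) ^ 1 \<le> max 1 (cmod z) ^ order z p" by (intro power_increasing) auto
    then show "max 1 (cmod z) \<le> max 1 (cmod z) ^ order z p" by simp
  qed auto
  also have "\<dots> \<le> cmod (lead_coeff p) * \<dots>"
    using mult_right_mono[OF assms(1), of "\<Prod>z\<in>?R. max 1 (cmod z) ^ order z p"]
    by (simp add: prod_nonneg)
  finally show ?thesis by (simp add: mahler_measure_def)
qed

text \<open>The orders of the roots add up to the degree, hence to at most \<open>card S\<close>. So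
  \<open>S\<close> exhausts the roots and every root is simple.\<close>

lemma mahler_measure_eq_prod:
  assumes "lead_coeff p = 1" "\<And>z. z \<in> S \<Longrightarrow> poly p z = 0" "degree p \<le> card S" "finite S"
  shows "mahler_measure p = (\<Prod>z\<in>S. max 1 (cmod z))"
proof -
  let ?R = "{z. poly p z = 0}"
  have p0: "p \<noteq> 0" using assms(1) by auto
  have fin: "finite ?R" using p0 by (rule poly_roots_finite)
  have SR: "S \<subseteq> ?R" using assms(2) by auto
  have le: "1 \<le> order z p" if "z \<in> ?R" for z using that p0 by (simp add: order_root Suc_leI)
  have "degree p = (\<Sum>z\<in>?R. order z p)"
    using arg_cong[OF complex_poly_decompose[of p], of degree] p0
    by (simp add: degree_prod_sum_eq degree_power_eq)
  then have deg: "(\<Sum>z\<in>?R. order z p) \<le> card S" using assms(3) by simp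
  moreover have "card ?R \<le> (\<Sum>z\<in>?R. order z p)"
    using sum_mono[of ?R "\<lambda>_. 1" "\<lambda>z. order z p"] le by simp
  moreover have "card S \<le> card ?R" using SR fin by (rule card_mono[rotated])
  ultimately have card: "card S = card ?R" and eq: "(\<Sum>z\<in>?R. 1) = (\<Sum>z\<in>?R. order z p)" by auto
  have R: "?R = S" using card_subset_eq[OF fin SR card] by simp
  have ord: "order z p = 1" if "z \<in> ?R" for z
    using sum_mono_inv[OF eq le that fin] by simp
  show ?thesis using assms(1) R ord by (simp add: mahler_measure_def)
qed

section \<open>Embeddings and discriminants\<close>

lemma is_subfieldD:
  assumes "is_subfield F"
  shows "0 \<in> F" "1 \<in> F" "x \<in> F \<Longrightarrow> y \<in> F \<Longrightarrow> x + y \<in> F"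
    "x \<in> F \<Longrightarrow> y \<in> F \<Longrightarrow> x - y \<in> F" "x \<in> F \<Longrightarrow> y \<in> F \<Longrightarrow> x * y \<in> F"
    "x \<in> F \<Longrightarrow> inverse x \<in> F"
proof -
  note F = assms[unfolded is_subfield_def]
  show "0 \<in> F" "1 \<in> F" "x \<in> F \<Longrightarrow> y \<in> F \<Longrightarrow> x + y \<in> F"
    "x \<in> F \<Longrightarrow> y \<in> F \<Longrightarrow> x - y \<in> F" "x \<in> F \<Longrightarrow> y \<in> F \<Longrightarrow> x * y \<in> F" using F by auto
  show "inverse x \<in> F" if "x \<in> F" using F that by (cases "x = 0") auto
qed

lemma is_subfield_uminus: "is_subfield F \<Longrightarrow> x \<in> F \<Longrightarrow> - x \<in> F"
  using is_subfieldD(4)[of F 0 x] is_subfieldD(1)[of F] by simp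

lemma is_subfield_of_int:
  assumes "is_subfield F" shows "of_int m \<in> F"
proof -
  have nat: "of_nat n \<in> F" for n
    by (induction n) (auto intro: is_subfieldD[OF assms])
  show ?thesis
    by (cases m rule: int_cases2) (auto intro: nat is_subfield_uminus[OF assms])
qed

lemma is_subfield_of_rat:
  assumes "is_subfield F" shows "of_rat q \<in> F"
proof -
  obtain a b where q: "q = of_int a / of_int b" "b \<noteq> 0"
    by (cases q) (auto simp: Fract_of_int_quotient)
  then have "(of_rat q :: complex) = of_int a * inverse (of_int b)"
    by (simp only: of_rat_mult of_rat_inverse of_rat_of_int_eq divide_inverse)
  then show ?thesis
    by (simp only:) (intro is_subfieldD[OF assms] is_subfield_of_int[OF assms])
qed

lemma is_subfield_sum:
  assumes "is_subfield F" "\<And>i. i \<in> I \<Longrightarrow> f i \<in> F" shows "sum f I \<in> F"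
  using assms(2) by (induction I rule: infinite_finite_induct) (auto intro: is_subfieldD[OF assms(1)])

lemma is_subfield_gen_field: "is_subfield (gen_field a)"
  unfolding gen_field_def is_subfield_def by blast

lemma gen_field_mem: "a \<in> gen_field a"
  unfolding gen_field_def by blast

lemma gen_field_least: "is_subfield F \<Longrightarrow> a \<in> F \<Longrightarrow> gen_field a \<subseteq> F"
  unfolding gen_field_def by blast

section \<open>Elementary properties of field embeddings\<close>

context
  fixes K \<sigma>
  assumes K: "is_subfield K" and emb: "\<sigma> \<in> embeddings K"
begin

lemma embedding_add: "x \<in> K \<Longrightarrow> y \<in> K \<Longrightarrow> \<sigma> (x + y) = \<sigma> x + \<sigma> y"
  and embedding_mult: "x \<in> K \<Longrightarrow> y \<in> K \<Longrightarrow> \<sigma> (x * y) = \<sigma> x * \<sigma> y"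
  and embedding_1: "\<sigma> 1 = 1"
  using emb unfolding embeddings_def by auto

lemma embedding_0: "\<sigma> 0 = 0"
  using embedding_add[of 0 0] is_subfieldD(1)[OF K] by simp

lemma embedding_diff: "x \<in> K \<Longrightarrow> y \<in> K \<Longrightarrow> \<sigma> (x - y) = \<sigma> x - \<sigma> y"
  using embedding_add[of "x - y" y] is_subfieldD(4)[OF K] by simp

lemma embedding_inverse: 
  assumes "x \<in> K" "x \<noteq> 0" shows "\<sigma> (inverse x) = inverse (\<sigma> x)"
proof -
  have "\<sigma> x * \<sigma> (inverse x) = 1"
    using embedding_mult[of x "inverse x"] is_subfieldD(6)[OF K, of x] assms embedding_1 by simp
  then show ?thesis by (metis inverse_unique)
qed

lemma embedding_of_int: "\<sigma> (of_int m) = of_int m"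
proof -
  have nat: "\<sigma> (of_nat n) = of_nat n" for n
  proof (induction n)
    case (Suc n)
    have "of_nat n \<in> K" using is_subfield_of_int[OF K, of "int n"] by simp
    then show ?case using embedding_add[of 1 "of_nat n"] Suc embedding_1 is_subfieldD(2)[OF K] by simp
  qed (simp add: embedding_0)
  show ?thesis
  proof (cases m rule: int_cases2)
    case (nonpos n)
    have "of_nat n \<in> K" using is_subfield_of_int[OF K, of "int n"] by simp
    then show ?thesis using nonpos embedding_diff[of 0 "of_nat n"] is_subfieldD(1)[OF K] nat embedding_0 by simp
  qed (use nat in simp)
qed

lemma embedding_of_rat: "\<sigma> (of_rat q) = of_rat q"
proof -
  obtain a b where q: "q = of_int a / of_int b" "b \<noteq> 0"
    by (cases q) (auto simp: Fract_of_int_quotient)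
  then have "(of_rat q :: complex) = of_int a * inverse (of_int b)"
    by (simp only: of_rat_mult of_rat_inverse of_rat_of_int_eq divide_inverse)
  then show ?thesis
    using q(2) embedding_mult[of "of_int a" "inverse (of_int b)"] embedding_inverse[of "of_int b"]
      is_subfield_of_int[OF K] is_subfieldD(6)[OF K] by (simp add: embedding_of_int)
qed

lemma embedding_sum: "(\<And>i. i \<in> I \<Longrightarrow> f i \<in> K) \<Longrightarrow> \<sigma> (sum f I) = (\<Sum>i\<in>I. \<sigma> (f i))"
  by (induction I rule: infinite_finite_induct)
     (auto simp: embedding_0 embedding_add is_subfield_sum[OF K])

end

text \<open>With \<open>gen_field_least\<close>, embeddings that agree on a generator agree on the
  whole field.\<close>

lemma is_subfield_equalizer:
  assumes K: "is_subfield K" and emb: "\<sigma> \<in> embeddings K" "\<tau> \<in> embeddings K"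
  shows "is_subfield {x \<in> K. \<sigma> x = \<tau> x}"
  using is_subfieldD[OF K] emb assms
  unfolding is_subfield_def
  by (auto simp: embedding_add[OF K] embedding_mult[OF K] embedding_diff[OF K]
      embedding_0[OF K] embedding_1[OF K] embedding_inverse[OF K])

lemma embedding_poly:
  assumes K: "is_subfield K" and emb: "\<sigma> \<in> embeddings K" and x: "x \<in> K"
  shows "poly (map_poly of_int p) x \<in> K"
    and "\<sigma> (poly (map_poly of_int p) x) = poly (map_poly of_int p) (\<sigma> x)"
proof -
  have "poly (map_poly of_int p) x \<in> K \<and> \<sigma> (poly (map_poly of_int p) x) = poly (map_poly of_int p) (\<sigma> x)"
  proof (induction p)
    case 0
    then show ?case using is_subfieldD(1)[OF K] embedding_0[OF K emb] by simp
  next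
    case (pCons a p)
    then show ?case
      using x is_subfieldD(3,5)[OF K] is_subfield_of_int[OF K]
      by (simp add: map_poly_pCons embedding_add[OF K emb] embedding_mult[OF K emb] embedding_of_int[OF K emb])
  qed
  then show "poly (map_poly of_int p) x \<in> K"
    "\<sigma> (poly (map_poly of_int p) x) = poly (map_poly of_int p) (\<sigma> x)" by auto
qed

section \<open>Traces and change of integral basis\<close>

lemma trace_K_int_lincomb:
  assumes K: "is_subfield K" and x: "\<And>i. i \<in> I \<Longrightarrow> x i \<in> K"
  shows "trace_K K (\<Sum>i\<in>I. of_int (c i) * x i) = (\<Sum>i\<in>I. of_int (c i) * trace_K K (x i))"
proof -
  have "trace_K K (\<Sum>i\<in>I. of_int (c i) * x i) = (\<Sum>\<sigma>\<in>embeddings K. \<Sum>i\<in>I. of_int (c i) * \<sigma> (x i))"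
    unfolding trace_K_def
    by (intro sum.cong refl)
       (simp add: embedding_sum[OF K] embedding_mult[OF K] embedding_of_int[OF K] x
         is_subfield_of_int[OF K] is_subfieldD(5)[OF K])
  also have "\<dots> = (\<Sum>i\<in>I. of_int (c i) * trace_K K (x i))"
    unfolding trace_K_def sum_distrib_left by (rule sum.swap)
  finally show ?thesis .
qed

lemma integral_basisD:
  assumes "integral_basis K n w"
  shows "i < n \<Longrightarrow> w i \<in> K" "i < n \<Longrightarrow> w i \<in> ring_of_integers K"
  using assms by (auto simp: integral_basis_def ring_of_integers_def)

lemma integral_basis_coords:
  assumes "integral_basis K n w" "x \<in> ring_of_integers K"
  shows "\<exists>c :: nat \<Rightarrow> int. x = (\<Sum>i<n. of_int (c i) * w i)"
  using assms unfolding integral_basis_def by blast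

text \<open>The definition asserts uniqueness among extensional coefficient functions; restricting
  arbitrary ones to the index range brings them into that form.\<close>

lemma integral_basis_unique:
  fixes c d :: "nat \<Rightarrow> int"
  assumes "integral_basis K n w" "x \<in> ring_of_integers K"
    "x = (\<Sum>i<n. of_int (c i) * w i)" "x = (\<Sum>i<n. of_int (d i) * w i)" "i < n"
  shows "c i = d i"
proof -
  have ex1: "\<exists>!c. c \<in> {..<n} \<rightarrow>\<^sub>E (UNIV :: int set) \<and> x = (\<Sum>i<n. of_int (c i) * w i)"
    using assms(1,2) unfolding integral_basis_def by blast
  have "restrict c {..<n} \<in> {..<n} \<rightarrow>\<^sub>E (UNIV :: int set) \<and> x = (\<Sum>i<n. of_int (restrict c {..<n} i) * w i)"
    "restrict d {..<n} \<in> {..<n} \<rightarrow>\<^sub>E (UNIV :: int set) \<and> x = (\<Sum>i<n. of_int (restrict d {..<n} i) * w i)"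
    using assms(3,4) by auto
  then have "restrict c {..<n} = restrict d {..<n}" using ex1 by blast
  then show ?thesis using assms(5) by (metis lessThan_iff restrict_apply)
qed

text \<open>Substitute one change of coordinates into the other and compare coefficients. The
  lengths \<open>n\<close> and \<open>m\<close> are kept apart because their equality is derived
  from this lemma.\<close>

lemma integral_basis_inverse:
  fixes A B :: "nat \<Rightarrow> nat \<Rightarrow> int"
  assumes w: "integral_basis K n w"
    and A: "\<And>i. i < n \<Longrightarrow> w i = (\<Sum>j<m. of_int (A i j) * e j)"
    and B: "\<And>j. j < m \<Longrightarrow> e j = (\<Sum>i<n. of_int (B j i) * w i)"
    and "i < n" "l < n"
  shows "(\<Sum>j<m. A i j * B j l) = (if l = i then 1 else 0)"
proof -
  have "w i = (\<Sum>j<m. of_int (A i j) * (\<Sum>l<n. of_int (B j l) * w l))"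
    using A[OF \<open>i < n\<close>] B by simp
  also have "\<dots> = (\<Sum>l<n. of_int (\<Sum>j<m. A i j * B j l) * w l)"
    by (simp add: sum_distrib_left sum_distrib_right mult.assoc) (rule sum.swap)
  finally have 1: "w i = \<dots>" .
  have 2: "w i = (\<Sum>l<n. of_int (if l = i then 1 else 0) * w l)"
    using \<open>i < n\<close> by (simp add: if_distrib[of of_int] if_distrib[of "\<lambda>x. x * _"] sum.delta cong: if_cong)
  show ?thesis
    using integral_basis_unique[OF w integral_basisD(2)[OF w \<open>i < n\<close>] 1 2 \<open>l < n\<close>] .
qed

text \<open>\<open>abs_disc\<close> picks an integral basis by choice, so its value is determined
  only through this independence.\<close>

lemma integral_basis_disc_eq:
  assumes K: "is_subfield K" and w: "integral_basis K n w" and e: "integral_basis K m e"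
  shows "cmod (det (mat n n (\<lambda>(i, j). trace_K K (w i * w j)))) =
         cmod (det (mat m m (\<lambda>(i, j). trace_K K (e i * e j))))"
proof -
  have "\<exists>A :: nat \<Rightarrow> nat \<Rightarrow> int. \<forall>i<n. w i = (\<Sum>j<m. of_int (A i j) * e j)"
    using integral_basis_coords[OF e integral_basisD(2)[OF w]] by (intro choice_iff'[THEN iffD1]) auto
  then obtain A :: "nat \<Rightarrow> nat \<Rightarrow> int" where A: "\<And>i. i < n \<Longrightarrow> w i = (\<Sum>j<m. of_int (A i j) * e j)"
    by blast
  have "\<exists>A :: nat \<Rightarrow> nat \<Rightarrow> int. \<forall>i<m. e i = (\<Sum>j<n. of_int (A i j) * w j)"
    using integral_basis_coords[OF w integral_basisD(2)[OF e]] by (intro choice_iff'[THEN iffD1]) auto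
  then obtain B :: "nat \<Rightarrow> nat \<Rightarrow> int" where B: "\<And>i. i < m \<Longrightarrow> e i = (\<Sum>j<n. of_int (B i j) * w j)"
    by blast
  note AB = integral_basis_inverse[OF w A B] and BA = integral_basis_inverse[OF e B A]
  \<comment> \<open>the trace of \<open>AB = I\<close> equals that of \<open>BA = I\<close>\<close>
  have "int n = (\<Sum>i<n. \<Sum>j<m. A i j * B j i)" using AB by simp
  also have "\<dots> = (\<Sum>j<m. \<Sum>i<n. B j i * A i j)" by (subst sum.swap) (simp add: mult.commute)
  also have "\<dots> = int m" using BA by simp
  finally have nm: "m = n" by simp
  define MA MB where "MA = mat n n (\<lambda>(i, j). A i j)" and "MB = mat n n (\<lambda>(i, j). B i j)"
  have M: "MA \<in> carrier_mat n n" "MB \<in> carrier_mat n n" by (auto simp: MA_def MB_def)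
  have "MA * MB = 1\<^sub>m n"
    by (rule eq_matI) (use AB nm in \<open>auto simp: MA_def MB_def scalar_prod_def atLeast0LessThan\<close>)
  then have "det MA * det MB = 1" using det_mult[OF M] by simp
  \<comment> \<open>An integer determinant with an integer inverse is 1 or -1.\<close>
  then have dA: "\<bar>det MA\<bar> = 1" by (auto simp: zmult_eq_1_iff)
  let ?A = "map_mat complex_of_int MA"
  let ?G = "mat n n (\<lambda>(i, j). trace_K K (e i * e j))"
  have eK: "e j \<in> K" if "j < n" for j using integral_basisD(1)[OF e] that nm by simp
  \<comment> \<open>By linearity of the trace, the Gram matrix changes by the congruence G -> A G
    A^T, which multiplies its determinant by the square of det A.\<close>
  have "mat n n (\<lambda>(i, j). trace_K K (w i * w j)) = ?A * (?G * transpose_mat ?A)"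
  proof (rule eq_matI)
    fix i j assume "i < dim_row (?A * (?G * transpose_mat ?A))" "j < dim_col (?A * (?G * transpose_mat ?A))"
    then have ij: "i < n" "j < n" by (auto simp: MA_def)
    have in_K: "e r * e s \<in> K" if "r < n" "s < n" for r s
      using that by (intro is_subfieldD(5)[OF K] eK)
    have in_K': "(\<Sum>s<n. of_int (A j s) * (e r * e s)) \<in> K" if "r < n" for r
      using that eK by (intro is_subfield_sum[OF K] is_subfieldD(5)[OF K] is_subfield_of_int[OF K]) auto
    have "w i * w j = (\<Sum>r<n. of_int (A i r) * (\<Sum>s<n. of_int (A j s) * (e r * e s)))"
      unfolding A[OF ij(1)] A[OF ij(2)] sum_product nm
      by (intro sum.cong refl) (simp add: sum_distrib_left algebra_simps)
    then have "trace_K K (w i * w j) = (\<Sum>r<n. of_int (A i r) * (\<Sum>s<n. of_int (A j s) * trace_K K (e r * e s)))"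
      by (simp only:, subst trace_K_int_lincomb[OF K], blast intro: in_K')
         (intro sum.cong refl, subst trace_K_int_lincomb[OF K], auto intro: in_K)
    also have "\<dots> = (?A * (?G * transpose_mat ?A)) $$ (i, j)"
      using ij by (simp add: MA_def scalar_prod_def atLeast0LessThan sum_distrib_left algebra_simps)
    finally show "mat n n (\<lambda>(i, j). trace_K K (w i * w j)) $$ (i, j) = (?A * (?G * transpose_mat ?A)) $$ (i, j)"
      using ij by simp
  qed (auto simp: MA_def)
  also have "det \<dots> = det ?A * (det ?G * det ?A)"
  proof -
    have A': "?A \<in> carrier_mat n n" and G: "?G \<in> carrier_mat n n" using M by auto
    have T: "transpose_mat ?A \<in> carrier_mat n n" using A' by (rule transpose_carrier_mat[THEN iffD2])
    show ?thesis
      by (simp only: det_mult[OF A' mult_carrier_mat[OF G T]] det_mult[OF G T] det_transpose[OF A'])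
  qed
  also have "cmod \<dots> = cmod (det ?G)"
    using dA by (simp add: norm_mult flip: of_int_abs)
  finally show ?thesis using nm by simp
qed

section \<open>The quartic field\<close>

lemma rat_of_square_int:
  fixes q :: rat
  assumes "q\<^sup>2 = of_int m"
  obtains z where "q = of_int z"
proof -
  have "alg_int (of_rat q)" unfolding alg_int_def
  proof (intro exI[of _ "[:- m, 0, 1:]"] conjI)
    have "(of_rat q)\<^sup>2 = (of_int m :: complex)" using arg_cong[OF assms, of "of_rat :: rat \<Rightarrow> complex"] by (simp add: of_rat_power)
    then show "poly (map_poly of_int [:- m, 0, 1:]) (of_rat q :: complex) = 0" by (simp add: power2_eq_square)
  qed simp
  then show ?thesis using alg_int_of_ratD that by blast
qed

text \<open>The square of \<open>5 * q\<close> is an integer, so \<open>5 * q\<close> is one; as its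
  square is divisible by the prime 5, it is itself divisible by 5.\<close>

lemma rat_of_five_square_int:
  fixes q :: rat
  assumes "5 * q\<^sup>2 = of_int m"
  obtains z where "q = of_int z"
proof -
  have "(5 * q)\<^sup>2 = of_int (5 * m)" using assms by (simp add: power2_eq_square)
  then obtain y where y: "5 * q = of_int y" using rat_of_square_int by blast
  have "(of_int (y\<^sup>2) :: rat) = of_int (5 * m)" using assms y[symmetric] by (simp add: power2_eq_square)
  then have "y\<^sup>2 = 5 * m" by (simp only: of_int_eq_iff)
  then have "5 dvd y\<^sup>2" by simp
  moreover have "prime (5 :: int)" by simp
  ultimately have "5 dvd y" by (rule prime_dvd_power[rotated])
  then obtain z where "y = 5 * z" by (auto elim: dvdE)
  then show ?thesis using y that[of z] by simp
qed

lemma rat_square_neq_5: "(q :: rat)\<^sup>2 \<noteq> 5"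
proof
  assume q: "q\<^sup>2 = 5"
  then obtain z where z: "q = of_int z" using rat_of_square_int[of q 5] by auto
  then have "(of_int (z\<^sup>2) :: rat) = of_int 5" using q by simp
  then have z5: "z\<^sup>2 = 5" by (simp only: of_int_eq_iff)
  have "\<bar>z\<bar> < 3" by (rule power2_less_imp_less) (use z5 in auto)
  moreover have "\<bar>z\<bar> > 2" by (rule power2_less_imp_less) (use z5 in auto)
  ultimately show False by simp
qed

text \<open>Anisotropy of the norm form of Q(sqrt 5): a nontrivial zero would give a rational square
  root of 5.\<close>

lemma rat_norm_sqrt5_eq_0:
  fixes c d :: rat
  assumes "c\<^sup>2 = 5 * d\<^sup>2"
  shows "c = 0" "d = 0"
proof -
  show "d = 0"
  proof (rule ccontr)
    assume "d \<noteq> 0"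
    then have "(c / d)\<^sup>2 = 5" using assms by (simp add: power_divide)
    then show False using rat_square_neq_5 by blast
  qed
  then show "c = 0" using assms by simp
qed

lemma rat_sqrt5_independent:
  fixes s :: complex
  assumes "s\<^sup>2 = 5" "of_rat a + of_rat b * s = 0"
  shows "a = 0" "b = 0"
proof -
  have "of_rat a * of_rat a = (of_rat b * s) * (of_rat b * s)"
    using assms(2) by (simp add: eq_neg_iff_add_eq_0[symmetric])
  also have "\<dots> = of_rat b * of_rat b * s\<^sup>2" by (simp add: power2_eq_square)
  finally have "(of_rat (a\<^sup>2) :: complex) = of_rat (5 * b\<^sup>2)" using assms(1)
    by (simp add: of_rat_mult power2_eq_square)
  then have "a\<^sup>2 = 5 * b\<^sup>2" by (simp only: of_rat_eq_iff)
  then show "a = 0" "b = 0" by (auto dest: rat_norm_sqrt5_eq_0)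
qed

section \<open>Coordinates and conjugates in the quartic field\<close>

definition ev :: "complex \<Rightarrow> complex \<Rightarrow> rat \<Rightarrow> rat \<Rightarrow> rat \<Rightarrow> rat \<Rightarrow> complex" where
  "ev s t a b c d = of_rat a + of_rat b * s + (of_rat c + of_rat d * s) * t"

locale quartic_field =
  fixes k :: nat
  assumes k_pos: "k \<ge> 1"
begin

text \<open>The possible images of \<open>(\<surd>5, \<theta>)\<close> under an embedding of the field; the fixed rational
  coordinates of an element then give all its conjugates through \<open>ev\<close>.\<close>

definition conj_pairs :: "(complex \<times> complex) set" where
  "conj_pairs = {(s, t). s\<^sup>2 = 5 \<and> t\<^sup>2 = of_nat k * (5 + s)}"

lemma conj_pairsD: "(s, t) \<in> conj_pairs \<Longrightarrow> s\<^sup>2 = 5" "(s, t) \<in> conj_pairs \<Longrightarrow> t\<^sup>2 = of_nat k * (5 + s)"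
  by (auto simp: conj_pairs_def)

lemma ev_add: "ev s t a b c d + ev s t a' b' c' d' = ev s t (a + a') (b + b') (c + c') (d + d')"
  and ev_diff: "ev s t a b c d - ev s t a' b' c' d' = ev s t (a - a') (b - b') (c - c') (d - d')"
  by (simp_all add: ev_def of_rat_add of_rat_diff algebra_simps)

text \<open>The structure constants do not depend on the chosen pair; this is what makes passing
  from one pair to another multiplicative.\<close>

lemma ev_mult:
  assumes "(s, t) \<in> conj_pairs"
  shows "ev s t a b c d * ev s t a' b' c' d' =
    ev s t (a * a' + 5 * b * b' + 5 * of_nat k * (c * c' + 5 * d * d' + c * d' + d * c'))
      (a * b' + b * a' + of_nat k * (c * c' + 5 * d * d' + 5 * (c * d' + d * c')))
      (a * c' + 5 * b * d' + c * a' + 5 * d * b') (a * d' + b * c' + c * b' + d * a')"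
proof -
  have *: "(A + B * s + (C + D * s) * t) * (A' + B' * s + (C' + D' * s) * t) =
     A * A' + 5 * B * B' + 5 * \<kappa> * (C * C' + 5 * D * D' + C * D' + D * C') +
      (A * B' + B * A' + \<kappa> * (C * C' + 5 * D * D' + 5 * (C * D' + D * C'))) * s +
      ((A * C' + 5 * B * D' + C * A' + 5 * D * B') + (A * D' + B * C' + C * B' + D * A') * s) * t"
    if "s\<^sup>2 = 5" "t\<^sup>2 = \<kappa> * (5 + s)" for A B C D A' B' C' D' \<kappa> s t :: complex
  proof -
    have s: "s * s = 5" "s * (s * x) = 5 * x" for x using that(1) by (simp_all add: power2_eq_square flip: mult.assoc)
    have t: "t * t = \<kappa> * (5 + s)" "t * (t * x) = \<kappa> * (5 + s) * x" for x
      using that(2) by (simp_all add: power2_eq_square flip: mult.assoc)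
    show ?thesis by (simp add: algebra_simps s t)
  qed
  show ?thesis unfolding ev_def of_rat_add of_rat_mult of_rat_of_nat_eq of_rat_numeral_eq
    by (rule *[OF conj_pairsD[OF assms]])
qed

text \<open>Rational independence of 1, s, t, st, which amounts to \<open>t\<close> being quadratic
  over Q(s). The obstruction is that \<open>k (5 + s)\<close> has norm 20 k^2, which is 5 times a
  rational square.\<close>

lemma ev_eq_0D:
  assumes "(s, t) \<in> conj_pairs" "ev s t a b c d = 0"
  shows "a = 0" "b = 0" "c = 0" "d = 0"
proof -
  note st = conj_pairsD[OF assms(1)]
  let ?k = "of_nat k :: rat"
  \<comment> \<open>Moving the \<open>t\<close> part to the other side and squaring leaves a
    relation in Q(s), whose two coordinates give equations \<open>1\<close> and \<open>2\<close>
    below.\<close>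
  have "(of_rat a + of_rat b * s)\<^sup>2 = (of_rat c + of_rat d * s)\<^sup>2 * t\<^sup>2"
    using assms(2) unfolding ev_def eq_neg_iff_add_eq_0[symmetric] by (simp add: power_mult_distrib)
  then have "of_rat (a\<^sup>2 + 5 * b\<^sup>2 - ?k * (5 * (c\<^sup>2 + 5 * d\<^sup>2) + 10 * c * d))
     + of_rat (2 * a * b - ?k * (c\<^sup>2 + 5 * d\<^sup>2 + 10 * c * d)) * s = 0"
  proof -
    have s: "s * s = 5" "s * (s * x) = 5 * x" for x using st(1) by (simp_all add: power2_eq_square flip: mult.assoc)
    assume "(of_rat a + of_rat b * s)\<^sup>2 = (of_rat c + of_rat d * s)\<^sup>2 * t\<^sup>2"
    then show ?thesis unfolding st(2)
      by (simp add: of_rat_add of_rat_mult of_rat_diff of_rat_power power2_eq_square algebra_simps s)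
  qed
  from rat_sqrt5_independent[OF st(1) this]
  have 1: "a\<^sup>2 + 5 * b\<^sup>2 = ?k * (5 * (c\<^sup>2 + 5 * d\<^sup>2) + 10 * c * d)"
    and 2: "2 * a * b = ?k * (c\<^sup>2 + 5 * d\<^sup>2 + 10 * c * d)" by auto
  \<comment> \<open>taking norms, \<open>5\<close> would be a rational square unless \<open>c\<^sup>2 = 5 d\<^sup>2\<close>\<close>
  have "(a\<^sup>2 - 5 * b\<^sup>2)\<^sup>2 = 5 * (2 * ?k * (c\<^sup>2 - 5 * d\<^sup>2))\<^sup>2" 
  proof -
    have "(a\<^sup>2 - 5 * b\<^sup>2)\<^sup>2 = (a\<^sup>2 + 5 * b\<^sup>2)\<^sup>2 - 5 * (2 * a * b)\<^sup>2"
      by (simp add: power2_eq_square algebra_simps)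
    also have "\<dots> = 5 * (2 * ?k * (c\<^sup>2 - 5 * d\<^sup>2))\<^sup>2"
      unfolding 1 2 by (simp add: power2_eq_square algebra_simps)
    finally show ?thesis .
  qed
  from rat_norm_sqrt5_eq_0[OF this] have "c\<^sup>2 = 5 * d\<^sup>2" using k_pos by simp
  then show cd: "c = 0" "d = 0" by (auto dest: rat_norm_sqrt5_eq_0)
  then have "of_rat a + of_rat b * s = 0" using assms(2) by (simp add: ev_def)
  then show "a = 0" "b = 0" using rat_sqrt5_independent[OF st(1)] by auto
qed

lemma ev_eq_iff:
  assumes "(s, t) \<in> conj_pairs"
  shows "ev s t a b c d = ev s t a' b' c' d' \<longleftrightarrow> a = a' \<and> b = b' \<and> c = c' \<and> d = d'"
  using ev_eq_0D[OF assms, of "a - a'" "b - b'" "c - c'" "d - d'"] by (auto simp flip: ev_diff)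

definition \<theta> :: real where "\<theta> = sqrt (real k * (5 + sqrt 5))"
text \<open>The conjugate of \<theta> under sqrt 5 -> -sqrt 5. It is again real because sqrt 5 < 5,
  so the field is totally real.\<close>

definition \<theta>' :: real where "\<theta>' = sqrt (real k * (5 - sqrt 5))"

lemma sqrt5_bounds: "2 < sqrt 5" "sqrt 5 < 9/4"
  using real_less_rsqrt[of 2 5] real_less_lsqrt[of "9/4" 5] by (auto simp: power2_eq_square)

lemma \<theta>_sq: "\<theta>\<^sup>2 = real k * (5 + sqrt 5)" and \<theta>'_sq: "\<theta>'\<^sup>2 = real k * (5 - sqrt 5)"
  using sqrt5_bounds by (auto simp: \<theta>_def \<theta>'_def)

lemma \<theta>_pos: "\<theta> > 0" and \<theta>'_pos: "\<theta>' > 0"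
  using sqrt5_bounds k_pos by (auto simp: \<theta>_def \<theta>'_def intro!: mult_pos_pos)

abbreviation r5 :: complex where "r5 \<equiv> complex_of_real (sqrt 5)"
abbreviation \<theta>c :: complex where "\<theta>c \<equiv> complex_of_real \<theta>"

lemma conj_pairs_eq:
  "conj_pairs = {(r5, of_real \<theta>), (r5, - of_real \<theta>), (- r5, of_real \<theta>'), (- r5, - of_real \<theta>')}"
proof -
  have r: "r5\<^sup>2 = 5" by (simp flip: of_real_power)
  have t: "(of_real \<theta>)\<^sup>2 = of_nat k * (5 + r5)"
    using arg_cong[OF \<theta>_sq, of complex_of_real] by simp
  have t': "(of_real \<theta>')\<^sup>2 = of_nat k * (5 - r5)"
    using arg_cong[OF \<theta>'_sq, of complex_of_real] by simp
  have s: "s\<^sup>2 = 5 \<longleftrightarrow> s = r5 \<or> s = - r5" for s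
    using power2_eq_iff[of s r5] by (simp add: r)
  show ?thesis unfolding conj_pairs_def using r t t'
    by (auto simp: s) (metis power2_eq_iff)+
qed

lemma base_pair: "(r5, \<theta>c) \<in> conj_pairs"
  by (simp add: conj_pairs_eq)

lemma sum_conj_pairs:
  "sum f conj_pairs = f (r5, of_real \<theta>) + f (r5, - of_real \<theta>) + f (- r5, of_real \<theta>') + f (- r5, - of_real \<theta>')"
  and prod_conj_pairs: 
  "prod g conj_pairs = g (r5, of_real \<theta>) * g (r5, - of_real \<theta>) * g (- r5, of_real \<theta>') * g (- r5, - of_real \<theta>')"
  and card_conj_pairs: "card conj_pairs = 4"
  for f :: "complex \<times> complex \<Rightarrow> complex" and g :: "complex \<times> complex \<Rightarrow> real"
  using \<theta>_pos \<theta>'_pos unfolding conj_pairs_eq by (auto simp: algebra_simps)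

section \<open>The field \<open>L\<close>, its generator and its embeddings\<close>

definition L :: "complex set" where
  "L = {ev r5 \<theta>c a b c d | a b c d. True}"

lemma ev_in_L [intro, simp]: "ev r5 \<theta>c a b c d \<in> L"
  by (auto simp: L_def)

lemma LE:
  assumes "x \<in> L" obtains a b c d where "x = ev r5 \<theta>c a b c d"
  using assms by (auto simp: L_def)

lemma of_rat_eq_ev: "of_rat q = ev s t q 0 0 0"
  by (simp add: ev_def)

lemma L_mult: "x \<in> L \<Longrightarrow> y \<in> L \<Longrightarrow> x * y \<in> L"
  by (elim LE) (simp add: ev_mult[OF base_pair])

text \<open>Multiplying by the conjugate under \<theta> -> -\<theta> lands in Q(sqrt 5), and by a
  further conjugate in Q. The inverse is the product of these conjugates divided by the norm
  \<open>n\<close>.\<close>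

lemma L_inverse:
  assumes "x \<in> L" "x \<noteq> 0" shows "inverse x \<in> L"
proof -
  from assms(1) obtain a b c d where x: "x = ev r5 \<theta>c a b c d" by (rule LE)
  let ?x' = "ev r5 \<theta>c a b (- c) (- d)"
  obtain e f where ef: "x * ?x' = ev r5 \<theta>c e f 0 0"
    by (simp add: x ev_mult[OF base_pair])
  let ?x'' = "ev r5 \<theta>c e (- f) 0 0"
  obtain n where n: "x * ?x' * ?x'' = of_rat n"
    unfolding ef of_rat_eq_ev[of _ r5 \<theta>c] by (simp add: ev_mult[OF base_pair])
  have zero: "ev r5 \<theta>c a b c d = 0 \<longleftrightarrow> a = 0 \<and> b = 0 \<and> c = 0 \<and> d = 0" for a b c d
    using ev_eq_iff[OF base_pair, of a b c d 0 0 0 0] of_rat_eq_ev[of 0 r5 \<theta>c] by simp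
  have "?x' \<noteq> 0" using assms(2) by (simp add: x zero)
  then have "ev r5 \<theta>c e f 0 0 \<noteq> 0" using assms(2) ef by (metis mult_eq_0_iff)
  then have "?x'' \<noteq> 0" by (simp add: zero)
  then have "of_rat n \<noteq> (0 :: complex)" using n \<open>?x' \<noteq> 0\<close> assms(2) by auto
  then have "x * (?x' * ?x'' * of_rat (inverse n)) = 1"
    unfolding mult.assoc[symmetric] n by (simp add: of_rat_inverse)
  then have "inverse x = ?x' * ?x'' * of_rat (inverse n)" by (rule inverse_unique)
  then show ?thesis by (simp only: of_rat_eq_ev[of _ r5 \<theta>c]) (intro L_mult ev_in_L)
qed

lemma is_subfield_L: "is_subfield L"
  unfolding is_subfield_def
proof (intro conjI ballI impI)
  show "0 \<in> L" "1 \<in> L"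
    using ev_in_L[of 0 0 0 0] ev_in_L[of 1 0 0 0] by (simp_all add: ev_def)
qed (auto elim!: LE simp: ev_add ev_diff L_inverse intro: L_mult)

lemma ev_in_subfield:
  assumes "is_subfield F" "s \<in> F" "t \<in> F"
  shows "ev s t a b c d \<in> F"
  unfolding ev_def by (intro is_subfieldD[OF assms(1)] is_subfield_of_rat[OF assms(1)] assms)

lemma L_eq_gen_field: "L = gen_field \<theta>c"
proof
  show "gen_field \<theta>c \<subseteq> L"
  proof (rule gen_field_least[OF is_subfield_L])
    have "\<theta>c = ev r5 \<theta>c 0 0 1 0" by (simp add: ev_def)
    then show "\<theta>c \<in> L" by (metis ev_in_L)
  qed
  have sub: "is_subfield (gen_field \<theta>c)" by (rule is_subfield_gen_field)
  \<comment> \<open>Solve \<theta>^2 = k (5 + sqrt 5) for sqrt 5.\<close>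
  have "r5 = \<theta>c * \<theta>c * inverse (of_int (int k)) - of_int 5"
    using conj_pairsD(2)[OF base_pair] k_pos by (simp add: power2_eq_square field_simps)
  then have "r5 \<in> gen_field \<theta>c"
    by (simp only:) (intro is_subfieldD[OF sub] is_subfield_of_int[OF sub] gen_field_mem)
  then show "L \<subseteq> gen_field \<theta>c"
    by (auto elim!: LE intro!: ev_in_subfield[OF sub] gen_field_mem)
qed

text \<open>The \<open>THE\<close> is legitimate because coordinates with respect to the base pair
  are unique. The restriction to \<open>L\<close> matches the extensional functions in
  \<open>embeddings\<close>.\<close>

definition emb :: "complex \<times> complex \<Rightarrow> complex \<Rightarrow> complex" where
  "emb = (\<lambda>(s, t). restrict (\<lambda>x. THE y. \<exists>a b c d. x = ev r5 \<theta>c a b c d \<and> y = ev s t a b c d) L)"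

lemma emb_ev [simp]: "emb (s, t) (ev r5 \<theta>c a b c d) = ev s t a b c d"
  by (simp add: emb_def ev_eq_iff[OF base_pair])

lemma ev_0_0_1_0: "ev s t 0 0 1 0 = t" and ev_0_1_0_0: "ev s t 0 1 0 0 = s"
  and ev_1: "ev s t 1 0 0 0 = 1"
  by (auto simp: ev_def)

lemma emb_in_embeddings:
  assumes "st \<in> conj_pairs" shows "emb st \<in> embeddings L"
proof -
  obtain s t where st: "st = (s, t)" by force
  have "emb (s, t) 1 = 1" using emb_ev[of s t 1 0 0 0] by (simp only: ev_1)
  moreover have "emb (s, t) \<in> extensional L" by (auto simp: emb_def)
  ultimately show ?thesis using assms
    by (auto simp: st embeddings_def PiE_def ev_add ev_mult[OF base_pair] ev_mult elim!: LE)
qed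

text \<open>An embedding is determined by the images of sqrt 5 and \<theta>, and these satisfy the
  equations defining \<open>conj_pairs\<close>.\<close>

lemma embeddings_L: "embeddings L = emb ` conj_pairs"
proof (intro equalityI subsetI)
  fix \<sigma> assume \<sigma>: "\<sigma> \<in> embeddings L"
  note h = embedding_add[OF is_subfield_L \<sigma>] embedding_mult[OF is_subfield_L \<sigma>]
    embedding_of_rat[OF is_subfield_L \<sigma>]
  have L: "r5 \<in> L" "\<theta>c \<in> L" "\<And>q. of_rat q \<in> L"
    using ev_in_L[of 0 1 0 0] ev_in_L[of 0 0 1 0] is_subfield_of_rat[OF is_subfield_L]
    by (simp_all only: ev_0_0_1_0 ev_0_1_0_0)
  note in_L = L is_subfieldD(3,5)[OF is_subfield_L]
  have sig: "\<sigma> (ev r5 \<theta>c a b c d) = ev (\<sigma> r5) (\<sigma> \<theta>c) a b c d" for a b c d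
    unfolding ev_def by (simp add: h in_L)
  have "\<sigma> r5 * \<sigma> r5 = \<sigma> (of_rat 5)"
    using conj_pairsD(1)[OF base_pair] by (simp add: h(2)[symmetric] L power2_eq_square)
  then have 1: "(\<sigma> r5)\<^sup>2 = 5" using h(3)[of 5] by (simp add: power2_eq_square)
  have "\<sigma> \<theta>c * \<sigma> \<theta>c = \<sigma> (of_rat (of_nat k) * (of_rat 5 + r5))"
    using conj_pairsD(2)[OF base_pair] by (simp add: h(2)[symmetric] L power2_eq_square)
  also have "\<dots> = of_rat (of_nat k) * (of_rat 5 + \<sigma> r5)"
    by (simp only: h in_L)
  finally have 2: "(\<sigma> \<theta>c)\<^sup>2 = of_nat k * (5 + \<sigma> r5)" by (simp add: power2_eq_square)
  have "\<sigma> = emb (\<sigma> r5, \<sigma> \<theta>c)"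
  proof (rule extensionalityI[of _ L])
    show "\<sigma> \<in> extensional L" using \<sigma> by (auto simp: embeddings_def PiE_def)
    show "emb (\<sigma> r5, \<sigma> \<theta>c) \<in> extensional L" by (auto simp: emb_def)
    show "\<sigma> x = emb (\<sigma> r5, \<sigma> \<theta>c) x" if "x \<in> L" for x
      using that by (auto elim!: LE simp: sig)
  qed
  then show "\<sigma> \<in> emb ` conj_pairs" using 1 2 by (auto simp: conj_pairs_def)
qed (auto simp: emb_in_embeddings)

lemma inj_emb: "inj emb"
proof (rule injI)
  fix p q assume eq: "emb p = emb q"
  obtain s t s' t' where pq: "p = (s, t)" "q = (s', t')" by force
  show "p = q" using fun_cong[OF eq, of "ev r5 \<theta>c 0 1 0 0"] fun_cong[OF eq, of "ev r5 \<theta>c 0 0 1 0"]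
    unfolding pq emb_ev by (simp add: ev_0_0_1_0 ev_0_1_0_0)
qed

lemma trace_ev: "trace_K L (ev r5 \<theta>c a b c d) = of_rat (4 * a)"
proof -
  have "trace_K L (ev r5 \<theta>c a b c d) = (\<Sum>p\<in>conj_pairs. emb p (ev r5 \<theta>c a b c d))"
    unfolding trace_K_def embeddings_L by (rule sum.reindex_cong[OF inj_on_subset[OF inj_emb]]) auto
  \<comment> \<open>The \<theta> terms cancel over each sign of sqrt 5, and the sqrt 5 terms cancel
    between the signs.\<close>
  also have "\<dots> = of_rat (4 * a)"
    unfolding sum_conj_pairs emb_ev by (simp add: ev_def of_rat_mult algebra_simps)
  finally show ?thesis .
qed

end

section \<open>The ring of integers\<close>

text \<open>\<open>golden a b\<close> says that \<open>a + b \<surd>5\<close> lies in \<open>\<int>[\<phi>]\<close>.\<close>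

definition golden :: "rat \<Rightarrow> rat \<Rightarrow> bool" where
  "golden a b \<longleftrightarrow> (\<exists>m n :: int. a = of_int m + of_int n / 2 \<and> b = of_int n / 2)"

text \<open>For \<open>K = 2 k\<close> the two expressions are the coordinates of \<open>(x + y \<phi>)\<^sup>2 \<theta>\<^sup>2\<close> with respect
  to \<open>1, \<phi>\<close>, since \<open>\<theta>\<^sup>2 = 2 k (2 + \<phi>)\<close>.\<close>

lemma prime_dvd_golden_square:
  fixes q :: int and x y K :: int
  assumes q: "prime q" and sf: "\<And>p :: int. prime p \<Longrightarrow> \<not> p\<^sup>2 dvd K" and K5: "coprime K 5"
    and d1: "q\<^sup>2 dvd K * (2 * (x\<^sup>2 + y\<^sup>2) + (2 * x * y + y\<^sup>2))"
    and d2: "q\<^sup>2 dvd K * ((x\<^sup>2 + y\<^sup>2) + 3 * (2 * x * y + y\<^sup>2))"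
  shows "q dvd x \<and> q dvd y"
\<comment> \<open>With P = x^2 + y^2 and Q = 2xy + y^2, the hypotheses concern K(2P + Q) and K(P +
  3Q). This linear system has determinant 5, so the prime 5 is treated apart.\<close>
proof (cases "q = 5")
  case True
  have "coprime (q\<^sup>2) K" using K5 unfolding True coprime_power_left_iff by (simp add: coprime_commute)
  then have "q\<^sup>2 dvd 2 * (x\<^sup>2 + y\<^sup>2) + (2 * x * y + y\<^sup>2)" using d1 coprime_dvd_mult_right_iff by blast
  then have "q\<^sup>2 dvd 2 * (2 * (x\<^sup>2 + y\<^sup>2) + (2 * x * y + y\<^sup>2))" by (rule dvd_mult)
  \<comment> \<open>Completing the square: divisibility modulo 5 controls \<open>2 * x + y\<close>,
    and then modulo 25 controls \<open>y\<close>.\<close>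
  also have "2 * (2 * (x\<^sup>2 + y\<^sup>2) + (2 * x * y + y\<^sup>2)) = (2 * x + y)\<^sup>2 + 5 * y\<^sup>2"
    by (simp add: power2_eq_square algebra_simps)
  finally have d: "25 dvd (2 * x + y)\<^sup>2 + 5 * y\<^sup>2" using True by simp
  then have "5 dvd (2 * x + y)\<^sup>2 + 5 * y\<^sup>2" by (rule dvd_trans[rotated]) simp
  then have "5 dvd (2 * x + y)\<^sup>2" by (simp add: dvd_add_left_iff)
  then have e: "5 dvd 2 * x + y" using prime_dvd_power[of 5 "2 * x + y" 2] by simp
  then have "5\<^sup>2 dvd (2 * x + y)\<^sup>2" by (rule dvd_power_same)
  then have "25 dvd 5 * y\<^sup>2" using d by (simp add: dvd_add_right_iff)
  then have "5 dvd y\<^sup>2" by presburger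
  then have y: "5 dvd y" using prime_dvd_power[of 5 y 2] by simp
  then have "5 dvd x" using e by presburger
  then show ?thesis using y True by simp
next
  case False
  have prim: "prime (5 :: int)" by simp
  have cop5: "coprime q 5" using q prim False by (rule primes_coprime)
  \<comment> \<open>\<open>K\<close> is not divisible by the square of \<open>q\<close>, and 5 is
    prime to \<open>q\<close>, so some factor \<open>q\<close> must come from
    \<open>z\<close>.\<close>
  have key: "q dvd z" if "q\<^sup>2 dvd K * (5 * z)" for z
  proof (rule ccontr)
    assume "\<not> q dvd z"
    then have "coprime q z" using q prime_imp_coprime by blast
    then have "coprime (q\<^sup>2) (5 * z)" using cop5 by simp
    then have "q\<^sup>2 dvd K" using that coprime_dvd_mult_left_iff by blast
    then show False using sf q by blast
  qed
  let ?P = "x\<^sup>2 + y\<^sup>2" and ?Q = "2 * x * y + y\<^sup>2"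
  have "K * (5 * ?P) = 3 * (K * (2 * ?P + ?Q)) - K * (?P + 3 * ?Q)"
    by (simp add: algebra_simps)
  also have "q\<^sup>2 dvd \<dots>" by (rule dvd_diff[OF dvd_mult[OF d1] d2])
  finally have P: "q dvd ?P" by (rule key)
  have "K * (5 * ?Q) = 2 * (K * (?P + 3 * ?Q)) - K * (2 * ?P + ?Q)"
    by (simp add: algebra_simps)
  also have "q\<^sup>2 dvd \<dots>" by (rule dvd_diff[OF dvd_mult[OF d2] d1])
  finally have "q dvd ?Q" by (rule key)
  also have "?Q = y * (2 * x + y)" by (simp add: power2_eq_square algebra_simps)
  finally consider "q dvd y" | "q dvd 2 * x + y" using q prime_dvd_multD by blast
  then show ?thesis
  proof cases
    case 1
    then have "q dvd y\<^sup>2" by (simp add: power2_eq_square)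
    then have "q dvd x\<^sup>2" using P dvd_add_left_iff by blast
    then show ?thesis using 1 q prime_dvd_power by blast
  next
    case 2
    \<comment> \<open>Modulo \<open>2 * x + y\<close>, y is -2x and hence P is 5x^2.\<close>
    have "5 * x\<^sup>2 = ?P - (y - 2 * x) * (2 * x + y)" by (simp add: power2_eq_square algebra_simps)
    also have "q dvd \<dots>" using P 2 by (intro dvd_diff dvd_mult)
    finally have "q dvd 5 * x\<^sup>2" .
    then have "q dvd x\<^sup>2" using cop5 coprime_dvd_mult_right_iff by blast
    then have x: "q dvd x" using q prime_dvd_power by blast
    then have "q dvd y" using 2 by (simp add: dvd_add_right_iff)
    then show ?thesis using x by simp
  qed
qed

text \<open>Descent on the least common denominator \<open>n\<close> of \<open>X\<close> and
  \<open>Y\<close>: a prime factor of \<open>n\<close> would divide both numerators by the previous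
  lemma, and could be cancelled.\<close>

lemma golden_square_integral:
  fixes X Y :: rat and K :: int
  assumes sf: "\<And>p :: int. prime p \<Longrightarrow> \<not> p\<^sup>2 dvd K" and K5: "coprime K 5"
    and g: "of_int K * (2 * (X\<^sup>2 + Y\<^sup>2) + (2 * X * Y + Y\<^sup>2)) = of_int g"
    and h: "of_int K * ((X\<^sup>2 + Y\<^sup>2) + 3 * (2 * X * Y + Y\<^sup>2)) = of_int h"
  shows "\<exists>x y :: int. X = of_int x \<and> Y = of_int y"
proof -
  define S where "S = (\<lambda>n :: nat. n > 0 \<and> (\<exists>x y :: int. of_nat n * X = of_int x \<and> of_nat n * Y = of_int y))"
  have "\<exists>n. S n"
  proof -
    obtain a b where ab: "X = of_int a / of_int b" "b > 0" by (cases X) (auto simp: Fract_of_int_quotient)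
    obtain c d where cd: "Y = of_int c / of_int d" "d > 0" by (cases Y) (auto simp: Fract_of_int_quotient)
    have "of_nat (nat (b * d)) * X = of_int (a * d)" "of_nat (nat (b * d)) * Y = of_int (c * b)"
      using ab cd by (auto simp: of_nat_nat)
    then have "S (nat (b * d))" using ab cd unfolding S_def
      by (intro conjI exI[of _ "a * d"] exI[of _ "c * b"]) auto
    then show ?thesis by blast
  qed
  define n where "n = (LEAST n. S n)"
  have Sn: "S n" using \<open>\<exists>n. S n\<close> unfolding n_def by (rule LeastI_ex)
  have least: "n \<le> m" if "S m" for m using that unfolding n_def by (rule Least_le)
  obtain x y :: int where xy: "of_nat n * X = of_int x" "of_nat n * Y = of_int y" and n0: "n > 0"
    using Sn by (auto simp: S_def)
  have "n = 1"
  proof (rule ccontr)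
    assume "n \<noteq> 1"
    then obtain p :: nat where p: "prime p" "p dvd n" using prime_factor_nat by blast
    then obtain m where m: "n = p * m" by (auto elim: dvdE)
    have "(of_int (K * (2 * (x\<^sup>2 + y\<^sup>2) + (2 * x * y + y\<^sup>2))) :: rat) =
        of_nat n ^ 2 * (of_int K * (2 * (X\<^sup>2 + Y\<^sup>2) + (2 * X * Y + Y\<^sup>2)))"
      unfolding of_int_mult of_int_add of_int_power xy[symmetric] by (simp add: power2_eq_square algebra_simps)
    also have "\<dots> = of_int (int n ^ 2 * g)" unfolding g by simp
    finally have "K * (2 * (x\<^sup>2 + y\<^sup>2) + (2 * x * y + y\<^sup>2)) = int n ^ 2 * g"
      by (simp only: of_int_eq_iff)
    then have d1: "int p ^ 2 dvd K * (2 * (x\<^sup>2 + y\<^sup>2) + (2 * x * y + y\<^sup>2))" by (simp add: m power_mult_distrib)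
    have "(of_int (K * ((x\<^sup>2 + y\<^sup>2) + 3 * (2 * x * y + y\<^sup>2))) :: rat) =
        of_nat n ^ 2 * (of_int K * ((X\<^sup>2 + Y\<^sup>2) + 3 * (2 * X * Y + Y\<^sup>2)))"
      unfolding of_int_mult of_int_add of_int_power xy[symmetric] by (simp add: power2_eq_square algebra_simps)
    also have "\<dots> = of_int (int n ^ 2 * h)" unfolding h by simp
    finally have "K * ((x\<^sup>2 + y\<^sup>2) + 3 * (2 * x * y + y\<^sup>2)) = int n ^ 2 * h"
      by (simp only: of_int_eq_iff)
    then have d2: "int p ^ 2 dvd K * ((x\<^sup>2 + y\<^sup>2) + 3 * (2 * x * y + y\<^sup>2))" by (simp add: m power_mult_distrib)
    have "int p dvd x \<and> int p dvd y"
      using prime_dvd_golden_square[OF _ sf K5 d1 d2] p(1) by simp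
    then obtain x' y' where xy': "x = int p * x'" "y = int p * y'" by (auto elim!: dvdE)
    have p0: "p > 1" using p(1) prime_gt_1_nat by blast
    have "of_nat p * (of_nat m * X) = of_nat p * of_int x'" "of_nat p * (of_nat m * Y) = of_nat p * of_int y'"
      using xy by (simp_all add: m xy')
    then have "of_nat m * X = of_int x'" "of_nat m * Y = of_int y'" using p0 by auto
    then have "S m" using n0 m by (auto simp: S_def)
    then have "n \<le> m" by (rule least)
    then show False using m p0 n0 by simp
  qed
  then show ?thesis using xy by auto
qed

text \<open>The hypotheses are the coordinates with respect to 1, \<phi> of (p + r \<phi>)^2 - (x +
  y \<phi>)^2 \<theta>^2 = 4 (e + f \<phi>). Reducing modulo 2 makes \<open>r\<close> and
  \<open>p\<close> even; after cancelling a factor 2, \<open>y\<close> and \<open>x\<close> follow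
  since \<open>k\<close> is odd.\<close>

lemma golden_relation_even:
  fixes p r x y e f k :: int
  assumes "odd k"
    and 1: "p\<^sup>2 + r\<^sup>2 - 2 * k * (2 * (x\<^sup>2 + y\<^sup>2) + (2 * x * y + y\<^sup>2)) = 4 * e"
    and 2: "2 * p * r + r\<^sup>2 - 2 * k * ((x\<^sup>2 + y\<^sup>2) + 3 * (2 * x * y + y\<^sup>2)) = 4 * f"
  shows "even p \<and> even r \<and> even x \<and> even y"
proof -
  have "even (2 * p * r + r\<^sup>2 - 2 * k * ((x\<^sup>2 + y\<^sup>2) + 3 * (2 * x * y + y\<^sup>2)))" unfolding 2 by simp
  then have r: "even r" by simp
  have "even (p\<^sup>2 + r\<^sup>2 - 2 * k * (2 * (x\<^sup>2 + y\<^sup>2) + (2 * x * y + y\<^sup>2)))" unfolding 1 by simp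
  then have p: "even p" using r by simp
  obtain p' r' where pr: "p = 2 * p'" "r = 2 * r'" using p r by (auto elim!: evenE)
  have "2 * (k * (2 * (x\<^sup>2 + y\<^sup>2) + (2 * x * y + y\<^sup>2))) = 2 * (2 * (p'\<^sup>2 + r'\<^sup>2 - e))"
    using 1 unfolding pr by (simp add: power2_eq_square algebra_simps)
  then have "k * (2 * (x\<^sup>2 + y\<^sup>2) + (2 * x * y + y\<^sup>2)) = 2 * (p'\<^sup>2 + r'\<^sup>2 - e)" by simp
  then have "even (k * (2 * (x\<^sup>2 + y\<^sup>2) + (2 * x * y + y\<^sup>2)))" by simp
  then have y: "even y" using \<open>odd k\<close> by simp
  have "2 * (k * ((x\<^sup>2 + y\<^sup>2) + 3 * (2 * x * y + y\<^sup>2))) = 2 * (2 * (2 * p' * r' + r'\<^sup>2 - f))"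
    using 2 unfolding pr by (simp add: power2_eq_square algebra_simps)
  then have "k * ((x\<^sup>2 + y\<^sup>2) + 3 * (2 * x * y + y\<^sup>2)) = 2 * (2 * p' * r' + r'\<^sup>2 - f)" by simp
  then have "even (k * ((x\<^sup>2 + y\<^sup>2) + 3 * (2 * x * y + y\<^sup>2)))" by simp
  then have "even x" using \<open>odd k\<close> y by simp
  then show ?thesis using p r y by simp
qed

section \<open>Integrality in coordinates\<close>

context quartic_field
begin

lemma root_conj:
  assumes "(s, t) \<in> conj_pairs" "poly (map_poly of_int p) (ev r5 \<theta>c a b c d) = 0"
  shows "poly (map_poly of_int p) (ev s t a b c d) = 0"
  using embedding_poly(2)[OF is_subfield_L emb_in_embeddings[OF assms(1)] ev_in_L, of p a b c d]
    embedding_0[OF is_subfield_L emb_in_embeddings[OF assms(1)]] assms(2) by simp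

lemma alg_int_conj:
  assumes "(s, t) \<in> conj_pairs" "alg_int (ev r5 \<theta>c a b c d)"
  shows "alg_int (ev s t a b c d)"
  using assms(2) root_conj[OF assms(1)] unfolding alg_int_def by blast

text \<open>The trace \<open>2 * a\<close> and the norm a^2 - 5 b^2 are rational algebraic integers.
  Hence \<open>2 * b\<close> is an integer too, of the same parity as \<open>2 * a\<close>.\<close>

lemma golden_if_alg_int:
  assumes "alg_int (ev r5 \<theta>c a b 0 0)"
  shows "golden a b"
proof -
  \<comment> \<open>This pair restricts to the nontrivial automorphism of Q(sqrt 5).\<close>
  have pair: "(- r5, of_real \<theta>') \<in> conj_pairs" by (simp add: conj_pairs_eq)
  note c = alg_int_conj[OF pair assms]
  have "ev r5 \<theta>c a b 0 0 + ev (- r5) (of_real \<theta>') a b 0 0 = of_rat (2 * a)"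
    by (simp add: ev_def of_rat_mult)
  then have "alg_int (of_rat (2 * a))" using alg_int_add[OF assms c] by simp
  then obtain A where A: "2 * a = of_int A" by (rule alg_int_of_ratD)
  have "ev r5 \<theta>c a b 0 0 * ev (- r5) (of_real \<theta>') a b 0 0 = of_rat a ^ 2 - of_rat b ^ 2 * r5\<^sup>2"
    by (simp add: ev_def power2_eq_square algebra_simps)
  also have "\<dots> = of_rat (a\<^sup>2 - 5 * b\<^sup>2)"
    unfolding conj_pairsD(1)[OF base_pair] by (simp add: of_rat_diff of_rat_mult of_rat_power)
  finally have "alg_int (of_rat (a\<^sup>2 - 5 * b\<^sup>2))" using alg_int_mult[OF assms c] by simp
  then obtain N where N: "a\<^sup>2 - 5 * b\<^sup>2 = of_int N" by (rule alg_int_of_ratD)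
  have eq: "5 * (2 * b)\<^sup>2 = (2 * a)\<^sup>2 - 4 * of_int N" unfolding N[symmetric] by (simp add: power2_eq_square)
  then have "5 * (2 * b)\<^sup>2 = of_int (A\<^sup>2 - 4 * N)" unfolding A by simp
  then obtain B where B: "2 * b = of_int B" by (rule rat_of_five_square_int)
  have "(of_int (5 * B\<^sup>2) :: rat) = of_int (A\<^sup>2 - 4 * N)" using eq unfolding A B by simp
  then have "5 * B\<^sup>2 = A\<^sup>2 - 4 * N" by (simp only: of_int_eq_iff)
  then have "A\<^sup>2 = 5 * B\<^sup>2 + 4 * N" by simp
  then have "even (A\<^sup>2) \<longleftrightarrow> even (B\<^sup>2)" by simp
  then have "even (A - B)" by simp
  then obtain M where "A - B = 2 * M" by (rule evenE)
  then have M: "A = B + 2 * M" by simp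
  have "2 * a = of_int B + 2 * of_int M" using A M by simp
  then show ?thesis unfolding golden_def using B by (intro exI[of _ M] exI[of _ B]) auto
qed

text \<open>Such an element lies in Z[\<phi>] + Z[\<phi>] \<theta>, where \<phi> is a root of X^2 -
  X - 1 and \<theta> of (X^2 - 5k)^2 - 5k^2.\<close>

lemma alg_int_if_golden:
  assumes "golden a b" "golden c d"
  shows "alg_int (ev r5 \<theta>c a b c d)"
proof -
  note st = conj_pairsD[OF base_pair]
  have phi: "alg_int ((1 + r5) / 2)" unfolding alg_int_def
    using st(1) by (intro exI[of _ "[:-1, -1, 1:]"]) (simp add: power2_eq_square field_simps)
  have "(\<theta>c\<^sup>2 - 5 * of_nat k)\<^sup>2 = 5 * of_nat k ^ 2"
    unfolding st(2) using st(1) by (simp add: algebra_simps power_mult_distrib)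
  then have th: "alg_int \<theta>c" unfolding alg_int_def
    by (intro exI[of _ "[:20 * int k ^ 2, 0, - 10 * int k, 0, 1:]"])
       (simp add: power2_eq_square algebra_simps)
  from assms obtain m n m' n' :: int where
    *: "a = of_int m + of_int n / 2" "b = of_int n / 2" "c = of_int m' + of_int n' / 2" "d = of_int n' / 2"
    unfolding golden_def by blast
  have "ev r5 \<theta>c a b c d = of_int m + of_int n * ((1 + r5) / 2) + (of_int m' + of_int n' * ((1 + r5) / 2)) * \<theta>c"
    unfolding ev_def * by (simp add: of_rat_add of_rat_divide of_rat_mult field_simps)
  then show ?thesis by (simp only:) (intro alg_int_add alg_int_mult alg_int_of_int phi th)
qed

end

locale sqfree_quartic_field = quartic_field +
  assumes k_odd: "odd k" and k_sqfree: "squarefree k" and k_5: "coprime k 5"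
begin

lemma two_k_sqfree: "prime (p :: int) \<Longrightarrow> \<not> p\<^sup>2 dvd 2 * int k"
proof
  assume p: "prime p" and d: "p\<^sup>2 dvd 2 * int k"
  have "squarefree (2 * k)" using k_odd k_sqfree by (intro squarefree_mult_coprime) (auto intro: squarefree_prime)
  moreover obtain q where q: "p = int q" using p by (metis prime_ge_0_int zero_le_imp_eq_int)
  then have "int (q\<^sup>2) dvd int (2 * k)" using d by simp
  then have "q\<^sup>2 dvd 2 * k" by (simp only: int_dvd_int_iff)
  ultimately have "q dvd 1" by (rule squarefreeD)
  then show False using p q by simp
qed

text \<open>For u + v \<theta> the relative trace 2u and relative norm u^2 - v^2 \<theta>^2 lie in
  Z[\<phi>]. The descent first puts 2v into Z[\<phi>]; the parity lemma then halves 2u and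
  2v.\<close>

lemma alg_int_ev_iff: "alg_int (ev r5 \<theta>c a b c d) \<longleftrightarrow> golden a b \<and> golden c d"
proof (intro iffI)
  assume x: "alg_int (ev r5 \<theta>c a b c d)"
  let ?k = "of_nat k :: rat"
  have pair: "(r5, - of_real \<theta>) \<in> conj_pairs" by (simp add: conj_pairs_eq)
  have "ev r5 (- of_real \<theta>) a b c d = ev r5 \<theta>c a b (- c) (- d)"
    by (simp add: ev_def of_rat_minus algebra_simps)
  then have x': "alg_int (ev r5 \<theta>c a b (- c) (- d))" using alg_int_conj[OF pair x] by simp
  have "golden (2 * a) (2 * b)"
    using alg_int_add[OF x x'] by (intro golden_if_alg_int) (simp add: ev_add)
  then obtain p r where pr: "2 * a = of_int p + of_int r / 2" "2 * b = of_int r / 2"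
    unfolding golden_def by blast
  have "golden (a\<^sup>2 + 5 * b\<^sup>2 - 5 * ?k * (c\<^sup>2 + 5 * d\<^sup>2 + 2 * c * d))
      (2 * a * b - ?k * (c\<^sup>2 + 5 * d\<^sup>2 + 10 * c * d))"
    using alg_int_mult[OF x x'] 
    by (intro golden_if_alg_int) (simp add: ev_mult[OF base_pair] power2_eq_square algebra_simps)
  then obtain e f where ef: "a\<^sup>2 + 5 * b\<^sup>2 - 5 * ?k * (c\<^sup>2 + 5 * d\<^sup>2 + 2 * c * d) = of_int e + of_int f / 2"
    "2 * a * b - ?k * (c\<^sup>2 + 5 * d\<^sup>2 + 10 * c * d) = of_int f / 2"
    unfolding golden_def by blast
  \<comment> \<open>Coordinates of 2v with respect to 1, \<phi>; likewise 2u = p + r \<phi>, and the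
    relative norm is e + f \<phi>.\<close>
  define X Y where "X = 2 * c - 2 * d" and "Y = 4 * d"
  have ab: "a = of_int p / 2 + of_int r / 4" "b = of_int r / 4" using pr by auto
  have cd: "c = X / 2 + Y / 4" "d = Y / 4" by (auto simp: X_def Y_def field_simps)
  have "of_int e = a\<^sup>2 + 5 * b\<^sup>2 - 5 * ?k * (c\<^sup>2 + 5 * d\<^sup>2 + 2 * c * d) - (2 * a * b - ?k * (c\<^sup>2 + 5 * d\<^sup>2 + 10 * c * d))"
    using ef by simp
  then have 1: "of_int p ^ 2 + of_int r ^ 2 - 2 * ?k * (2 * (X\<^sup>2 + Y\<^sup>2) + (2 * X * Y + Y\<^sup>2)) = 4 * of_int e"
    unfolding ab cd by (simp add: power2_eq_square field_simps)
  have "of_int f = 2 * (2 * a * b - ?k * (c\<^sup>2 + 5 * d\<^sup>2 + 10 * c * d))"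
    using ef by simp
  then have 2: "2 * of_int p * of_int r + of_int r ^ 2 - 2 * ?k * ((X\<^sup>2 + Y\<^sup>2) + 3 * (2 * X * Y + Y\<^sup>2)) = 4 * of_int f"
    unfolding ab cd by (simp add: power2_eq_square field_simps)
  \<comment> \<open>By \<open>1\<close> and \<open>2\<close>, (2v)^2 \<theta>^2 is (2u)^2 minus four
    times the relative norm, so its coordinates are integers.\<close>
  have "\<exists>x y :: int. X = of_int x \<and> Y = of_int y"
  proof (rule golden_square_integral[OF two_k_sqfree])
    have "coprime (int k) (int 5)" using k_5 by (simp only: coprime_int_iff)
    then show "coprime (2 * int k) 5" by simp
    show "of_int (2 * int k) * (2 * (X\<^sup>2 + Y\<^sup>2) + (2 * X * Y + Y\<^sup>2)) = of_int (p\<^sup>2 + r\<^sup>2 - 4 * e)"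
      using 1 by simp
    show "of_int (2 * int k) * ((X\<^sup>2 + Y\<^sup>2) + 3 * (2 * X * Y + Y\<^sup>2)) = of_int (2 * p * r + r\<^sup>2 - 4 * f)"
      using 2 by simp
  qed
  then obtain x y :: int where xy: "X = of_int x" "Y = of_int y" by blast
  have "(of_int (p\<^sup>2 + r\<^sup>2 - 2 * int k * (2 * (x\<^sup>2 + y\<^sup>2) + (2 * x * y + y\<^sup>2))) :: rat) = of_int (4 * e)"
    using 1 unfolding xy by simp
  then have i1: "p\<^sup>2 + r\<^sup>2 - 2 * int k * (2 * (x\<^sup>2 + y\<^sup>2) + (2 * x * y + y\<^sup>2)) = 4 * e"
    by (simp only: of_int_eq_iff)
  have "(of_int (2 * p * r + r\<^sup>2 - 2 * int k * ((x\<^sup>2 + y\<^sup>2) + 3 * (2 * x * y + y\<^sup>2))) :: rat) = of_int (4 * f)"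
    using 2 unfolding xy by simp
  then have i2: "2 * p * r + r\<^sup>2 - 2 * int k * ((x\<^sup>2 + y\<^sup>2) + 3 * (2 * x * y + y\<^sup>2)) = 4 * f"
    by (simp only: of_int_eq_iff)
  have "even p \<and> even r \<and> even x \<and> even y"
    using golden_relation_even[OF _ i1 i2] k_odd by simp
  then obtain p' r' x' y' where "p = 2 * p'" "r = 2 * r'" "x = 2 * x'" "y = 2 * y'"
    by (auto elim!: evenE)
  then have "a = of_int p' + of_int r' / 2" "b = of_int r' / 2"
    "c = of_int x' + of_int y' / 2" "d = of_int y' / 2"
    unfolding ab cd xy by auto
  then show "golden a b \<and> golden c d" unfolding golden_def by blast
qed (simp add: alg_int_if_golden)

lemma ring_of_integers_L:
  "ring_of_integers L = {ev r5 \<theta>c a b c d | a b c d. golden a b \<and> golden c d}"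
  unfolding ring_of_integers_def by (auto simp: alg_int_ev_iff elim!: LE; blast)

text \<open>The Z-basis 1, \<phi>, \<theta>, \<phi> \<theta>.\<close>

definition basis :: "nat \<Rightarrow> complex" where
  "basis i = [ev r5 \<theta>c 1 0 0 0, ev r5 \<theta>c (1/2) (1/2) 0 0, ev r5 \<theta>c 0 0 1 0, ev r5 \<theta>c 0 0 (1/2) (1/2)] ! i"

lemma lessThan_4: "{..<4 :: nat} = {0, 1, 2, 3}" by auto

lemma less_4D: "i < 4 \<Longrightarrow> i \<in> {0, 1, 2, 3 :: nat}" by auto

lemma basis_lincomb:
  "(\<Sum>i<4. of_int (c i) * basis i) =
    ev r5 \<theta>c (of_int (c 0) + of_int (c 1) / 2) (of_int (c 1) / 2) (of_int (c 2) + of_int (c 3) / 2) (of_int (c 3) / 2)"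
  by (simp add: lessThan_4 basis_def numeral_2_eq_2 numeral_3_eq_3 ev_def of_rat_add of_rat_divide of_rat_mult field_simps)

lemma integral_basis_basis: "integral_basis L 4 basis"
  unfolding integral_basis_def
proof (intro conjI allI impI ballI)
  fix i :: nat assume "i < 4"
  then have "i \<in> {0, 1, 2, 3}" by (rule less_4D)
  moreover have "golden 1 0" "golden (1/2) (1/2)" "golden 0 0" unfolding golden_def
    by (rule exI[of _ 1] exI[of _ 0], rule exI[of _ 1] exI[of _ 0], simp)+
  ultimately show "basis i \<in> ring_of_integers L"
    unfolding ring_of_integers_def
    by (elim insertE emptyE) (simp_all add: basis_def alg_int_ev_iff)
next
  fix x assume "x \<in> ring_of_integers L"
  then obtain m n m' n' :: int where x: "x = ev r5 \<theta>c (of_int m + of_int n / 2) (of_int n / 2) (of_int m' + of_int n' / 2) (of_int n' / 2)"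
    unfolding ring_of_integers_L golden_def by blast
  define c where "c = restrict (\<lambda>i. [m, n, m', n'] ! i) {..<4 :: nat}"
  show "\<exists>!c. c \<in> {..<4} \<rightarrow>\<^sub>E (UNIV :: int set) \<and> x = (\<Sum>i<4. of_int (c i) * basis i)"
  proof (rule ex1I[of _ c], intro conjI)
    show "c \<in> {..<4} \<rightarrow>\<^sub>E (UNIV :: int set)" by (simp add: c_def)
    show "x = (\<Sum>i<4. of_int (c i) * basis i)"
      unfolding basis_lincomb x by (simp add: c_def numeral_2_eq_2 numeral_3_eq_3)
    fix d assume d: "d \<in> {..<4} \<rightarrow>\<^sub>E (UNIV :: int set) \<and> x = (\<Sum>i<4. of_int (d i) * basis i)"
    then have eq: "d 0 = m" "d 1 = n" "d 2 = m'" "d 3 = n'"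
      unfolding basis_lincomb x ev_eq_iff[OF base_pair] by auto
    show "d = c"
    proof (rule extensionalityI[of _ "{..<4}"])
      show "d i = c i" if "i \<in> {..<4}" for i
        using that eq unfolding lessThan_4 by (elim insertE emptyE) (simp_all add: c_def)
    qed (use d in \<open>auto simp: c_def PiE_def\<close>)
  qed
qed

end

section \<open>The discriminant of the quartic field\<close>

lemma det_2x2:
  fixes A :: "'a :: comm_ring_1 mat"
  assumes A: "A \<in> carrier_mat 2 2"
  shows "det A = A $$ (0, 0) * A $$ (1, 1) - A $$ (0, 1) * A $$ (1, 0)"
proof -
  have "mat_delete A 0 j \<in> carrier_mat 1 1" for j using mat_delete_carrier[OF A, of 0 j] by simp
  note d = det_single[OF this]
  have "det A = A $$ (0, 0) * mat_delete A 0 0 $$ (0, 0) - A $$ (0, 1) * mat_delete A 0 1 $$ (0, 0)"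
    unfolding laplace_expansion_row[OF A, of 0, simplified] by (simp add: numeral_2_eq_2 cofactor_def d)
  then show ?thesis using A by (simp add: mat_delete_def)
qed

context sqfree_quartic_field
begin

lemma trace_basis_mult:
  assumes "i < 4" "j < 4"
  shows "trace_K L (basis i * basis j) =
    [[4, 2, 0, 0], [2, 6, 0, 0], [0, 0, 20 * of_nat k, 20 * of_nat k],
     [0, 0, 20 * of_nat k, 40 * of_nat k]] ! i ! j"
proof -
  from less_4D[OF assms(1)] less_4D[OF assms(2)] show ?thesis
    by (elim insertE emptyE) (simp_all add: basis_def ev_mult[OF base_pair] trace_ev of_rat_mult)
qed

text \<open>Z[\<phi>] and Z[\<phi>] \<theta> are orthogonal for the trace form, so the Gram matrix
  splits into blocks of determinant 20 and 400 k^2.\<close>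

lemma det_gram: "det (mat 4 4 (\<lambda>(i, j). trace_K L (basis i * basis j))) = of_nat (8000 * k\<^sup>2)"
proof -
  define A D :: "complex mat" where "A = mat 2 2 (\<lambda>(i, j). [[4, 2], [2, 6]] ! i ! j)"
    and "D = mat 2 2 (\<lambda>(i, j). [[20 * of_nat k, 20 * of_nat k], [20 * of_nat k, 40 * of_nat k]] ! i ! j)"
  have AD: "A \<in> carrier_mat 2 2" "D \<in> carrier_mat 2 2" by (auto simp: A_def D_def)
  have "mat 4 4 (\<lambda>(i, j). trace_K L (basis i * basis j)) = four_block_mat A (0\<^sub>m 2 2) (0\<^sub>m 2 2) D"
  proof (rule eq_matI)
    fix i j assume "i < dim_row (four_block_mat A (0\<^sub>m 2 2) (0\<^sub>m 2 2) D)"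
      "j < dim_col (four_block_mat A (0\<^sub>m 2 2) (0\<^sub>m 2 2) D)"
    then have ij: "i < 4" "j < 4" using AD by auto
    from less_4D[OF this(1)] less_4D[OF this(2)]
    show "mat 4 4 (\<lambda>(i, j). trace_K L (basis i * basis j)) $$ (i, j) =
        four_block_mat A (0\<^sub>m 2 2) (0\<^sub>m 2 2) D $$ (i, j)"
      by (elim insertE emptyE) (simp_all add: trace_basis_mult A_def D_def)
  qed (use AD in auto)
  then show ?thesis
    using det_four_block_mat_lower_left_zero[OF AD(1) zero_carrier_mat refl AD(2)] det_2x2[OF AD(1)] det_2x2[OF AD(2)]
    by (simp add: A_def D_def power2_eq_square)
qed

lemma abs_disc_L: "abs_disc L = 8000 * (real k)\<^sup>2"
  unfolding abs_disc_def
proof (rule some_equality)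
  have g: "cmod (det (mat 4 4 (\<lambda>(i, j). trace_K L (basis i * basis j)))) = 8000 * (real k)\<^sup>2"
    unfolding det_gram norm_of_nat by simp
  then show "\<exists>n w. integral_basis L n w \<and>
      8000 * (real k)\<^sup>2 = cmod (det (mat n n (\<lambda>(i, j). trace_K L (w i * w j))))"
    by (intro exI[of _ 4] exI[of _ basis] conjI integral_basis_basis g[symmetric])
  fix D assume "\<exists>n w. integral_basis L n w \<and> D = cmod (det (mat n n (\<lambda>(i, j). trace_K L (w i * w j))))"
  then obtain n w where w: "integral_basis L n w" "D = cmod (det (mat n n (\<lambda>(i, j). trace_K L (w i * w j))))"
    by blast
  show "D = 8000 * (real k)\<^sup>2"
    unfolding w(2) integral_basis_disc_eq[OF is_subfield_L w(1) integral_basis_basis] by (rule g)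
qed

end

section \<open>Mahler measures of generators\<close>

lemma of_real_of_rat: "of_real (of_rat q) = (of_rat q :: complex)"
  by (cases q) (simp add: of_rat_rat)

text \<open>The difference of \<open>u + w\<close> and \<open>u - w\<close> is 2w, so one of them is
  at least |w| in absolute value; the other factor is at least 1.\<close>

lemma abs_le_max_prod:
  fixes u w :: real
  shows "\<bar>w\<bar> \<le> max 1 \<bar>u + w\<bar> * max 1 \<bar>u - w\<bar>"
proof -
  have "max 1 \<bar>u + w\<bar> * 1 \<le> max 1 \<bar>u + w\<bar> * max 1 \<bar>u - w\<bar>" by (intro mult_left_mono) auto
  moreover have "1 * max 1 \<bar>u - w\<bar> \<le> max 1 \<bar>u + w\<bar> * max 1 \<bar>u - w\<bar>" by (intro mult_right_mono) auto
  moreover have "\<bar>w\<bar> \<le> \<bar>u + w\<bar> \<or> \<bar>w\<bar> \<le> \<bar>u - w\<bar>" by linarith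
  ultimately show ?thesis by (auto intro: order_trans[OF max.coboundedI2])
qed

section \<open>Products over the four conjugates\<close>

context quartic_field
begin

text \<open>The Mahler measure of the characteristic polynomial of the element: indexing by pairs
  counts coinciding conjugates with multiplicity.\<close>

definition conj_prod :: "rat \<Rightarrow> rat \<Rightarrow> rat \<Rightarrow> rat \<Rightarrow> real" where
  "conj_prod a b c d = (\<Prod>(s, t)\<in>conj_pairs. max 1 (cmod (ev s t a b c d)))"

lemma conj_prod_eq:
  "conj_prod a b c d =
    (max 1 \<bar>(of_rat a + of_rat b * sqrt 5) + (of_rat c + of_rat d * sqrt 5) * \<theta>\<bar> *
     max 1 \<bar>(of_rat a + of_rat b * sqrt 5) - (of_rat c + of_rat d * sqrt 5) * \<theta>\<bar>) *
    (max 1 \<bar>(of_rat a - of_rat b * sqrt 5) + (of_rat c - of_rat d * sqrt 5) * \<theta>'\<bar> *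
     max 1 \<bar>(of_rat a - of_rat b * sqrt 5) - (of_rat c - of_rat d * sqrt 5) * \<theta>'\<bar>)"
proof -
  have ev: "ev (of_real s) (of_real t) a b c d = of_real (of_rat a + of_rat b * s + (of_rat c + of_rat d * s) * t)"
    for s t :: real by (simp add: ev_def of_real_of_rat)
  have "conj_prod a b c d =
    max 1 (cmod (ev (of_real (sqrt 5)) (of_real \<theta>) a b c d)) *
    max 1 (cmod (ev (of_real (sqrt 5)) (of_real (- \<theta>)) a b c d)) *
    max 1 (cmod (ev (of_real (- sqrt 5)) (of_real \<theta>') a b c d)) *
    max 1 (cmod (ev (of_real (- sqrt 5)) (of_real (- \<theta>')) a b c d))"
    unfolding conj_prod_def prod_conj_pairs by simp
  then show ?thesis unfolding ev norm_of_real by simp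
qed

lemma inj_on_conj:
  assumes gen: "gen_field (ev r5 \<theta>c a b c d) = L"
  shows "inj_on (\<lambda>(s, t). ev s t a b c d) conj_pairs"
proof (rule inj_onI, clarify)
  fix s t s' t' assume st: "(s, t) \<in> conj_pairs" "(s', t') \<in> conj_pairs"
    and eq: "ev s t a b c d = ev s' t' a b c d"
  \<comment> \<open>The equalizer of the two embeddings is a subfield containing the generator,
    hence all of \<open>L\<close>, in particular sqrt 5 and \<theta>.\<close>
  have "L \<subseteq> {x \<in> L. emb (s, t) x = emb (s', t') x}"
    unfolding gen[symmetric]
    by (rule gen_field_least, unfold gen, rule is_subfield_equalizer)
       (use st eq in \<open>auto intro: emb_in_embeddings is_subfield_L\<close>)
  then have "emb (s, t) (ev r5 \<theta>c a b c d) = emb (s', t') (ev r5 \<theta>c a b c d)" for a b c d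
    by blast
  then have "ev s t a b c d = ev s' t' a b c d" for a b c d unfolding emb_ev .
  from this[of 0 1 0 0] this[of 0 0 1 0] show "s = s' \<and> t = t'"
    unfolding ev_0_0_1_0 ev_0_1_0_0 by simp
qed

text \<open>The four distinct conjugates are roots of the minimal polynomial, which suffices for the
  inequality. The degree bound adds that there are no further roots or multiplicities.\<close>

lemma
  assumes int: "alg_int (ev r5 \<theta>c a b c d)" and gen: "gen_field (ev r5 \<theta>c a b c d) = L"
  shows mahler_alg_ge_conj_prod: "conj_prod a b c d \<le> mahler_alg (ev r5 \<theta>c a b c d)"
    and mahler_alg_eq_conj_prod:
      "degree (min_poly_int (ev r5 \<theta>c a b c d)) \<le> 4 \<Longrightarrow> mahler_alg (ev r5 \<theta>c a b c d) = conj_prod a b c d"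
proof -
  let ?p = "min_poly_int (ev r5 \<theta>c a b c d)" and ?f = "\<lambda>(s, t). ev s t a b c d"
  let ?q = "map_poly complex_of_int ?p"
  note p = min_poly_int[OF int]
  have lc: "lead_coeff ?q = 1" and deg: "degree ?q = degree ?p" using p(2) by auto
  have root: "poly ?q z = 0" if "z \<in> ?f ` conj_pairs" for z using that root_conj[OF _ p(3)] by auto
  have prod: "(\<Prod>z\<in>?f ` conj_pairs. max 1 (cmod z)) = conj_prod a b c d"
    unfolding prod.reindex[OF inj_on_conj[OF gen]] conj_prod_def by (intro prod.cong) auto
  have card: "card (?f ` conj_pairs) = 4"
    unfolding card_image[OF inj_on_conj[OF gen]] by (rule card_conj_pairs)
  have fin: "finite (?f ` conj_pairs)" by (simp add: conj_pairs_eq)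
  show "conj_prod a b c d \<le> mahler_alg (ev r5 \<theta>c a b c d)"
    unfolding mahler_alg_def prod[symmetric] by (rule mahler_measure_ge_prod) (use lc root in auto)
  show "mahler_alg (ev r5 \<theta>c a b c d) = conj_prod a b c d" if "degree ?p \<le> 4"
    unfolding mahler_alg_def prod[symmetric]
    by (rule mahler_measure_eq_prod[OF lc root _ fin]) (use that card deg in simp_all)
qed

lemma \<theta>_mult_\<theta>': "\<theta> * \<theta>' = 2 * sqrt 5 * real k"
proof (rule power2_eq_imp_eq)
  show "(\<theta> * \<theta>')\<^sup>2 = (2 * sqrt 5 * real k)\<^sup>2"
    by (simp add: power_mult_distrib \<theta>_sq \<theta>'_sq) (simp add: power2_eq_square algebra_simps)
qed (use \<theta>_pos \<theta>'_pos in auto)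

lemma conj_prod_ge:
  assumes "golden c d" "\<not> (c = 0 \<and> d = 0)"
  shows "2 * sqrt 5 * real k \<le> conj_prod a b c d"
proof -
  obtain m n :: int where mn: "c = of_int m + of_int n / 2" "d = of_int n / 2"
    using assms(1) unfolding golden_def by blast
  \<comment> \<open>The norm of v = m + n \<phi>, a nonzero integer.\<close>
  define N where "N = m\<^sup>2 + m * n - n\<^sup>2"
  have "c\<^sup>2 - 5 * d\<^sup>2 = of_int N" unfolding mn N_def by (simp add: power2_eq_square field_simps)
  moreover have "c\<^sup>2 \<noteq> 5 * d\<^sup>2" using rat_norm_sqrt5_eq_0[of c d] assms(2) by blast
  ultimately have N0: "N \<noteq> 0" and "c\<^sup>2 - 5 * d\<^sup>2 = of_int N" by auto
  let ?C = "of_rat c :: real" and ?D = "of_rat d :: real"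
  have "(?C + ?D * sqrt 5) * (?C - ?D * sqrt 5) = ?C\<^sup>2 - 5 * ?D\<^sup>2"
    by (simp add: power2_eq_square algebra_simps)
  also have "\<dots> = of_rat (c\<^sup>2 - 5 * d\<^sup>2)" by (simp add: of_rat_diff of_rat_mult of_rat_power)
  also have "\<dots> = of_int N" unfolding \<open>c\<^sup>2 - 5 * d\<^sup>2 = of_int N\<close> by simp
  finally have "1 \<le> \<bar>(?C + ?D * sqrt 5) * (?C - ?D * sqrt 5)\<bar>" using N0 by (simp flip: of_int_abs)
  then have "\<theta> * \<theta>' * 1 \<le> \<theta> * \<theta>' * \<bar>(?C + ?D * sqrt 5) * (?C - ?D * sqrt 5)\<bar>"
    using \<theta>_pos \<theta>'_pos by (intro mult_left_mono) auto
  then have "\<theta> * \<theta>' \<le> \<bar>(?C + ?D * sqrt 5) * \<theta>\<bar> * \<bar>(?C - ?D * sqrt 5) * \<theta>'\<bar>"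
    using \<theta>_pos \<theta>'_pos by (simp add: abs_mult mult_ac)
  also have "\<dots> \<le> conj_prod a b c d"
    unfolding conj_prod_eq by (intro mult_mono abs_le_max_prod) auto
  finally show ?thesis unfolding \<theta>_mult_\<theta>' .
qed

section \<open>A generator of small Mahler measure\<close>

lemma degree_min_poly_int_le:
  assumes int: "alg_int (ev r5 \<theta>c a b 1 0)" and AB: "2 * a = of_int A" "2 * b = of_int B"
  shows "degree (min_poly_int (ev r5 \<theta>c a b 1 0)) \<le> 4"
proof -
  let ?\<alpha> = "ev r5 \<theta>c a b 1 0"
  \<comment> \<open>with \<open>z = 2 \<alpha> - A\<close>, squaring \<open>z - B \<surd>5 = 2 \<theta>\<close> and then eliminating \<open>\<surd>5\<close> gives \<open>S(z) = 0\<close>\<close>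
  define E where "E = 5 * B\<^sup>2 - 20 * int k"
  \<comment> \<open>The expansion of (Z^2 + E)^2 - 5 (2 B Z + 4 k)^2. Below, \<open>R\<close> is
    S(2X - A): it has leading coefficient 16, but only its degree matters.\<close>
  define S where "S = [:E\<^sup>2 - 80 * int k ^ 2, - 80 * B * int k, 2 * E - 20 * B\<^sup>2, 0, 1:]"
  define R where "R = S \<circ>\<^sub>p [:- A, 2:]"
  have deg: "degree R = 4" by (simp add: R_def S_def degree_pcompose)
  have "(of_rat (2 * a) :: complex) = of_int A" "(of_rat (2 * b) :: complex) = of_int B"
    unfolding AB by simp_all
  then have A: "of_int A = 2 * (of_rat a :: complex)" and B: "of_int B = 2 * (of_rat b :: complex)"
    by (simp_all add: of_rat_mult)
  define z where "z = 2 * ?\<alpha> - of_int A"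
  have z: "z - of_int B * r5 = 2 * \<theta>c" by (simp add: z_def A B ev_def)
  note st = conj_pairsD[OF base_pair]
  have "(z - of_int B * r5)\<^sup>2 = 4 * of_nat k * (5 + r5)" unfolding z by (simp add: power_mult_distrib st)
  then have "z\<^sup>2 + 5 * of_int B ^ 2 - 20 * of_nat k = r5 * (2 * of_int B * z + 4 * of_nat k)"
    by (simp add: power2_diff power_mult_distrib st(1) algebra_simps)
  then have "(z\<^sup>2 + of_int E)\<^sup>2 = r5\<^sup>2 * (2 * of_int B * z + 4 * of_nat k)\<^sup>2"
    by (simp add: E_def add_diff_eq flip: power_mult_distrib)
  then have "(z\<^sup>2 + of_int E)\<^sup>2 = 5 * (2 * of_int B * z + 4 * of_nat k)\<^sup>2" unfolding st(1) .
  then have "poly (map_poly of_int S) z = 0"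
    by (simp add: S_def power2_eq_square algebra_simps)
  moreover have "poly (map_poly of_int R) ?\<alpha> = poly (map_poly of_int S) z"
    by (simp add: R_def of_int_hom.map_poly_pcompose poly_pcompose z_def algebra_simps)
  ultimately have "min_poly_int ?\<alpha> dvd R"
    using irreducible_dvd_of_root[OF min_poly_int(1,3)[OF int]] by simp
  moreover have "R \<noteq> 0" using deg by auto
  ultimately show ?thesis using dvd_imp_degree_le deg by metis
qed

text \<open>Squaring y - b sqrt 5 = \<theta> gives a linear equation for sqrt 5 over the generated
  field. Solving it yields sqrt 5, and then \<theta>.\<close>

lemma gen_field_add_\<theta>: "gen_field (ev r5 \<theta>c a b 1 0) = L"
proof
  let ?\<alpha> = "ev r5 \<theta>c a b 1 0" and ?G = "gen_field (ev r5 \<theta>c a b 1 0)"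
  show "?G \<subseteq> L" by (intro gen_field_least is_subfield_L ev_in_L)
  have G: "is_subfield ?G" by (rule is_subfield_gen_field)
  define y where "y = ?\<alpha> - of_rat a"
  note in_G = is_subfieldD[OF G] is_subfield_of_rat[OF G]
  have y: "y \<in> ?G" unfolding y_def by (intro in_G gen_field_mem)
  have y': "y - of_rat b * r5 = \<theta>c" by (simp add: y_def ev_def)
  note st = conj_pairsD[OF base_pair]
  have "(y - of_rat b * r5)\<^sup>2 = of_nat k * (5 + r5)" unfolding y' st ..
  then have eq: "y * y + of_rat (5 * b\<^sup>2 - 5 * of_nat k) = r5 * (of_rat (2 * b) * y + of_rat (of_nat k))"
    by (simp add: power2_diff power_mult_distrib st(1) of_rat_diff of_rat_mult of_rat_power algebra_simps)
       (simp add: power2_eq_square algebra_simps)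
  \<comment> \<open>The coefficient of sqrt 5 is nonzero because its rational coordinate is
    \<open>k\<close>.\<close>
  have "of_rat (2 * b) * y + of_rat (of_nat k) = ev r5 \<theta>c (of_nat k) (2 * b\<^sup>2) (2 * b) 0"
    by (simp add: y_def ev_def of_rat_mult of_rat_power power2_eq_square algebra_simps)
  then have "of_rat (2 * b) * y + of_rat (of_nat k) \<noteq> 0"
    using ev_eq_0D(1)[OF base_pair, of "of_nat k"] k_pos by auto
  then have "r5 = (y * y + of_rat (5 * b\<^sup>2 - 5 * of_nat k)) * inverse (of_rat (2 * b) * y + of_rat (of_nat k))"
    unfolding eq by (simp add: field_simps)
  also have "\<dots> \<in> ?G" by (intro in_G y)
  finally have "r5 \<in> ?G" .
  then have "y - of_rat b * r5 \<in> ?G" by (intro in_G y)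
  then have "\<theta>c \<in> ?G" by (simp only: y')
  then show "L \<subseteq> ?G" unfolding L_eq_gen_field by (intro gen_field_least G)
qed

text \<open>For u = x + y \<phi> with conjugate u', u - u' = y sqrt 5 and u + u' = 2x + y. So
  \<open>y\<close> is obtained by rounding from \<theta> - \<theta>', and then \<open>x\<close> from
  \<theta> + \<theta>'.\<close>

lemma exists_golden_conj_prod_le:
  obtains A B :: int and a b :: rat where "golden a b" "2 * a = of_int A" "2 * b = of_int B"
    "conj_prod a b 1 0 \<le> 32 * sqrt 5 * real k"
proof -
  define y where "y = round ((\<theta> - \<theta>') / sqrt 5)"
  define x where "x = round ((\<theta> + \<theta>' - of_int y) / 2)"
  define a b :: rat where "a = of_int x + of_int y / 2" and "b = of_int y / 2"
  \<comment> \<open>\<open>e\<close> and \<open>f\<close> are the rounding errors in u - u' and u +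
    u': at most sqrt 5 / 2 < 9/8 and at most 1.\<close>
  define e where "e = of_int y * sqrt 5 - (\<theta> - \<theta>')"
  define f where "f = of_int (2 * x + y) - (\<theta> + \<theta>')"
  have "\<bar>of_int y - (\<theta> - \<theta>') / sqrt 5\<bar> \<le> 1 / 2" unfolding y_def by (rule of_int_round_abs_le)
  then have "sqrt 5 * \<bar>of_int y - (\<theta> - \<theta>') / sqrt 5\<bar> \<le> sqrt 5 * (1 / 2)" by (intro mult_left_mono) auto
  moreover have "sqrt 5 * \<bar>of_int y - (\<theta> - \<theta>') / sqrt 5\<bar> = \<bar>sqrt 5 * (of_int y - (\<theta> - \<theta>') / sqrt 5)\<bar>"
    by (simp add: abs_mult)
  moreover have "sqrt 5 * (of_int y - (\<theta> - \<theta>') / sqrt 5) = e" by (simp add: e_def field_simps)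
  ultimately have e: "\<bar>e\<bar> \<le> 9 / 8" using sqrt5_bounds by linarith
  have "\<bar>of_int x - (\<theta> + \<theta>' - of_int y) / 2\<bar> \<le> 1 / 2" unfolding x_def by (rule of_int_round_abs_le)
  moreover have "of_int x - (\<theta> + \<theta>' - of_int y) / 2 = f / 2" by (simp add: f_def field_simps)
  ultimately have f: "\<bar>f\<bar> \<le> 1" by simp
  \<comment> \<open>The constant 4/3 lies between the approximation error 17/16 and the smallest
    possible \<theta>', so that |u + \<theta>| is at most 2 \<theta> + 4/3 and hence at most 3
    \<theta>.\<close>
  have "(4 / 3)\<^sup>2 \<le> \<theta>\<^sup>2" "(4 / 3)\<^sup>2 \<le> \<theta>'\<^sup>2"
  proof -
    have "1 * (5 + sqrt 5) \<le> real k * (5 + sqrt 5)" "1 * (5 - sqrt 5) \<le> real k * (5 - sqrt 5)"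
      using k_pos sqrt5_bounds by (intro mult_right_mono; simp)+
    then have "16 / 9 \<le> \<theta>\<^sup>2" "16 / 9 \<le> \<theta>'\<^sup>2"
      unfolding \<theta>_sq \<theta>'_sq mult_1 using sqrt5_bounds by - linarith+
    then show "(4 / 3)\<^sup>2 \<le> \<theta>\<^sup>2" "(4 / 3)\<^sup>2 \<le> \<theta>'\<^sup>2" by (simp_all add: power_divide)
  qed
  then have th: "4 / 3 \<le> \<theta>" "4 / 3 \<le> \<theta>'"
    using \<theta>_pos \<theta>'_pos by (auto intro: power2_le_imp_le)
  let ?u = "of_rat a + of_rat b * sqrt 5" and ?u' = "of_rat a - of_rat b * sqrt 5"
  have ab: "of_rat a = of_int x + of_int y / (2 :: real)" "of_rat b = of_int y / (2 :: real)"
    by (auto simp: a_def b_def of_rat_add of_rat_divide)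
  have u: "?u - \<theta> = (e + f) / 2" "?u' - \<theta>' = (f - e) / 2"
    unfolding ab e_def f_def by (simp_all add: field_simps)
  have "\<bar>e + f\<bar> \<le> 8 / 3" "\<bar>f - e\<bar> \<le> 8 / 3" using e f by linarith+
  then have s: "\<bar>?u - \<theta>\<bar> \<le> 4 / 3" "\<bar>?u' - \<theta>'\<bar> \<le> 4 / 3" unfolding u by simp_all
  have l: "\<bar>?u + \<theta>\<bar> \<le> 3 * \<theta>" "\<bar>?u' + \<theta>'\<bar> \<le> 3 * \<theta>'" using s th by linarith+
  have "conj_prod a b 1 0 \<le> ((3 * \<theta>) * (4 / 3)) * ((3 * \<theta>') * (4 / 3))"
    unfolding conj_prod_eq using s l th by (intro mult_mono) (auto intro!: mult_nonneg_nonneg)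
  also have "\<dots> = 16 * (\<theta> * \<theta>')" by simp
  finally have "conj_prod a b 1 0 \<le> 32 * sqrt 5 * real k" unfolding \<theta>_mult_\<theta>' by simp
  moreover have "golden a b" unfolding golden_def a_def b_def by blast
  moreover have "2 * a = of_int (2 * x + y)" "2 * b = of_int y" by (auto simp: a_def b_def)
  ultimately show ?thesis using that by blast
qed

end

section \<open>Bounds for the minimal Mahler measure\<close>

context sqfree_quartic_field
begin

lemma mahler_OK_L_bounds: "2 * sqrt 5 * real k \<le> mahler_OK L" "mahler_OK L \<le> 32 * sqrt 5 * real k"
proof -
  define M where "M = {mahler_alg \<alpha> | \<alpha>. \<alpha> \<in> ring_of_integers L \<and> gen_field \<alpha> = L}"
  have lower: "2 * sqrt 5 * real k \<le> z" if "z \<in> M" for z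
  proof -
    from that obtain \<alpha> where z: "z = mahler_alg \<alpha>" "\<alpha> \<in> ring_of_integers L" "gen_field \<alpha> = L"
      unfolding M_def by blast
    then obtain a b c d where \<alpha>: "\<alpha> = ev r5 \<theta>c a b c d" and gold: "golden c d"
      unfolding ring_of_integers_L by blast
    have int: "alg_int (ev r5 \<theta>c a b c d)" using z(2) by (simp add: ring_of_integers_def \<alpha>)
    have gen: "gen_field (ev r5 \<theta>c a b c d) = L" using z(3) by (simp add: \<alpha>)
    \<comment> \<open>Otherwise the element would be fixed by \<theta> -> -\<theta> and could not
      generate \<open>L\<close>.\<close>
    have "\<not> (c = 0 \<and> d = 0)"
    proof
      assume "c = 0 \<and> d = 0"
      then have "ev r5 (of_real \<theta>) a b c d = ev r5 (- of_real \<theta>) a b c d" by (simp add: ev_def)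
      then have "(r5, complex_of_real \<theta>) = (r5, - of_real \<theta>)"
        using inj_onD[OF inj_on_conj[OF gen], of "(r5, of_real \<theta>)" "(r5, - of_real \<theta>)"]
        by (simp add: conj_pairs_eq)
      then show False using \<theta>_pos by simp
    qed
    then show ?thesis
      using conj_prod_ge[OF gold] mahler_alg_ge_conj_prod[OF int gen] unfolding z(1) \<alpha>
      by (meson order_trans)
  qed
  obtain A B :: int and a b where ab: "golden a b" "2 * a = of_int A" "2 * b = of_int B"
    and le: "conj_prod a b 1 0 \<le> 32 * sqrt 5 * real k"
    by (rule exists_golden_conj_prod_le)
  have "golden 1 0" unfolding golden_def by (intro exI[of _ 1] exI[of _ 0]) simp
  then have int: "alg_int (ev r5 \<theta>c a b 1 0)" using ab(1) by (intro alg_int_if_golden)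
  have mem: "conj_prod a b 1 0 \<in> M"
    unfolding M_def mahler_alg_eq_conj_prod[OF int gen_field_add_\<theta> degree_min_poly_int_le[OF int ab(2,3)], symmetric]
    using int gen_field_add_\<theta> by (auto simp: ring_of_integers_def)
  \<comment> \<open>\<open>lower\<close> bounds the set from below, so the infimum is at most the
    value at this one generator.\<close>
  have "Inf M \<le> conj_prod a b 1 0"
    using mem lower by (intro cInf_lower bdd_belowI[of M "2 * sqrt 5 * real k"]) auto
  then show "mahler_OK L \<le> 32 * sqrt 5 * real k" using le by (simp add: mahler_OK_def M_def)
  have "2 * sqrt 5 * real k \<le> Inf M" using mem lower by (intro cInf_greatest) auto
  then show "2 * sqrt 5 * real k \<le> mahler_OK L" by (simp add: mahler_OK_def M_def)
qed

end

theorem theorem5p3: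
  fixes k :: nat
  assumes "k \<ge> 1" and "odd k" and "squarefree k" and "coprime k 5"
  defines "K \<equiv> gen_field (complex_of_real (sqrt (real k * (5 + sqrt 5))))"
  shows "sqrt (abs_disc K) / 1920 \<le> mahler_OK K \<and> mahler_OK K \<le> sqrt (abs_disc K)"
proof -
  interpret sqfree_quartic_field k
    using assms(1-4) by unfold_locales
  have K: "K = L" unfolding K_def L_eq_gen_field \<theta>_def ..
  have "8000 * (real k)\<^sup>2 = (40 * sqrt 5 * real k)\<^sup>2" by (simp add: power_mult_distrib)
  then have "sqrt (abs_disc L) = 40 * sqrt 5 * real k" unfolding abs_disc_L by simp
  moreover have "0 \<le> sqrt 5 * real k" by simp
  \<comment> \<open>In units of sqrt 5 * k this compares 40/1920 with 2 and 32 with 40.\<close>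
  ultimately show ?thesis using mahler_OK_L_bounds unfolding K by linarith
qed

end
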